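(* Let $G$ be a finite simple graph and $n\ge2$. The inclusion $P_G^{(n)}\hookrightarrow\mathcal K_G^{(n)}$ induces an injective homomorphism of graded algebras $$R_G^{(n)}:=\frac{\mathbb Q[h_v:v\in V(G)]}{(h_v^n,\ \Delta_{uv}:v\in V(G),\ uv\in E(G))}\longrightarrow H^*(\mathcal K_G^{(n)}).$$ Its image consists precisely of the cohomology classes represented by elements of $g$-degree zero.
   Context: Put $P_G^{(n)}=\mathbb Q[h_v:v\in V(G)]/(h_v^n:v\in V(G))$ with $|h_v|=2$, and $\Delta_{uv}=\sum_{k=0}^{n-1}h_u^{n-1-k}h_v^k$ for $uv\in E(G)$. For each edge $e=uv$ introduce one odd generator $g_e=g_{uv}$ of degree $2n-3$. For a simple cycle with edges $e_1,\dots,e_k$ write $\partial(g_{e_1}\cdots g_{e_k})=\sum_{i=1}^k(-1)^{i-1}g_{e_1}\cdots\widehat{g_{e_i}}\cdots g_{e_k}$. The commutative differential graded algebra $\mathcal K_G^{(n)}$ is $\bigl(P_G^{(n)}\otimes\Lambda(g_e:e\in E(G))\bigr)/J_G$, where $J_G$ is the ideal generated by $(h_u-h_v)g_{uv}$ for $uv\in E(G)$ and by $\partial(g_{e_1}\cdots g_{e_k})$ for all simple cycles $(e_1,\dots,e_k)$ of $G$, with differential the derivation determined by $dh_v=0$ and $d(g_{uv})=\Delta_{uv}$. The $g$-degree is the auxiliary grading of $\mathcal K_G^{(n)}$ giving every $h_v$ degree $0$ and every $g_e$ degree $1$; $J_G$ is homogeneous for it, the differential lowers it by one, and the $g$-degree-zero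 summand is $P_G^{(n)}$. *)

theory Defs
  imports Complex_Main "HOL-Algebra.QuotRing" "HOL-Library.Poly_Mapping" "HOL-Library.FuncSet"
begin

section \<open>Graphs\<close>

definition simple_graph :: "'v set \<Rightarrow> 'v set set \<Rightarrow> bool" where
  "simple_graph V E \<longleftrightarrow> finite V \<and> (\<forall>e\<in>E. e \<subseteq> V \<and> card e = 2)"

text \<open>A simple cycle is given by its cyclic sequence of distinct vertices; its edges are listed in
  cyclic order, so every starting edge and both directions of traversal occur.\<close>

definition cycle_edges :: "'v list \<Rightarrow> 'v set list" where
  "cycle_edges vs = map (\<lambda>i. {vs ! i, vs ! (Suc i mod length vs)}) [0..<length vs]"

definition simple_cycle :: "'v set set \<Rightarrow> 'v set list \<Rightarrow> bool" where
  "simple_cycle E es \<longleftrightarrow>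
     (\<exists>vs. distinct vs \<and> 3 \<le> length vs \<and> es = cycle_edges vs \<and> set es \<subseteq> E)"


section \<open>Polynomials over the rationals\<close>

type_synonym 'v rpoly = "('v \<Rightarrow>\<^sub>0 nat) \<Rightarrow>\<^sub>0 rat"

definition hvar :: "'v \<Rightarrow> 'v rpoly" where
  "hvar v = Poly_Mapping.single (Poly_Mapping.single v 1) 1"

definition poly_const :: "rat \<Rightarrow> 'v rpoly" where
  "poly_const c = Poly_Mapping.single 0 c"

definition poly_ring :: "'v set \<Rightarrow> 'v rpoly ring" where
  "poly_ring V =
     \<lparr>carrier = {p. \<forall>m\<in>Poly_Mapping.keys p. Poly_Mapping.keys m \<subseteq> V},
      mult = (*), one = 1, zero = 0, add = (+)\<rparr>"

text \<open>Every variable has degree 2. Degrees are integers, and in a negative degree only the zero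
  polynomial is homogeneous.\<close>

definition mon_degree :: "('v \<Rightarrow>\<^sub>0 nat) \<Rightarrow> int" where
  "mon_degree m = 2 * (\<Sum>v\<in>Poly_Mapping.keys m. int (Poly_Mapping.lookup m v))"

definition poly_homogeneous :: "int \<Rightarrow> 'v rpoly \<Rightarrow> bool" where
  "poly_homogeneous k p \<longleftrightarrow> (\<forall>m\<in>Poly_Mapping.keys p. mon_degree m = k)"

definition Delta :: "nat \<Rightarrow> 'v \<Rightarrow> 'v \<Rightarrow> 'v rpoly" where
  "Delta n u v = (\<Sum>k<n. hvar u ^ (n - 1 - k) * hvar v ^ k)"

text \<open>\<open>Delta n\<close> is symmetric in the two vertices, so it depends only on the unordered edge.\<close>

definition edge_Delta :: "nat \<Rightarrow> 'v set \<Rightarrow> 'v rpoly" where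
  "edge_Delta n e = (THE p. \<forall>u v. e = {u, v} \<longrightarrow> p = Delta n u v)"


section \<open>Exterior algebras\<close>

text \<open>Let \<open>R\<close> be a commutative ring and \<open>E\<close> a finite set with a linear order \<open>r\<close>. The algebra
  \<open>R \<otimes> \<Lambda>(g\<^sub>e : e \<in> E)\<close> is the free \<open>R\<close>-module on the monomials \<open>g\<^sub>S\<close> for \<open>S \<subseteq> E\<close>, where \<open>g\<^sub>S\<close> is
  the product of the \<open>g\<^sub>e\<close> with \<open>e \<in> S\<close> in increasing order. An element is its family of
  coefficients. One has \<open>g\<^sub>S g\<^sub>T = (-1)^i g\<^bsub>S \<union> T\<^esub>\<close> if \<open>S\<close> and \<open>T\<close> are disjoint, with \<open>i\<close> the number
  of pairs \<open>s \<in> S\<close>, \<open>t \<in> T\<close> that are out of order, and \<open>g\<^sub>S g\<^sub>T = 0\<close> otherwise.\<close>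

definition inversions :: "'e rel \<Rightarrow> 'e set \<Rightarrow> 'e set \<Rightarrow> nat" where
  "inversions r S T = card {(s, t) \<in> S \<times> T. (t, s) \<in> r}"

definition sign_pow :: "('a, 'm) ring_scheme \<Rightarrow> nat \<Rightarrow> 'a" where
  "sign_pow R i = (\<ominus>\<^bsub>R\<^esub> \<one>\<^bsub>R\<^esub>) [^]\<^bsub>R\<^esub> i"

definition ext_alg ::
    "('a, 'm) ring_scheme \<Rightarrow> 'e set \<Rightarrow> 'e rel \<Rightarrow> ('e set \<Rightarrow> 'a) ring" where
  "ext_alg R E r =
     \<lparr>carrier = Pow E \<rightarrow>\<^sub>E carrier R,
      mult = (\<lambda>a b. \<lambda>S\<in>Pow E. \<Oplus>\<^bsub>R\<^esub>T\<in>Pow S.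
                 sign_pow R (inversions r T (S - T)) \<otimes>\<^bsub>R\<^esub> (a T \<otimes>\<^bsub>R\<^esub> b (S - T))),
      one = (\<lambda>S\<in>Pow E. if S = {} then \<one>\<^bsub>R\<^esub> else \<zero>\<^bsub>R\<^esub>),
      zero = (\<lambda>S\<in>Pow E. \<zero>\<^bsub>R\<^esub>),
      add = (\<lambda>a b. \<lambda>S\<in>Pow E. a S \<oplus>\<^bsub>R\<^esub> b S)\<rparr>"

definition ext_incl :: "('a, 'm) ring_scheme \<Rightarrow> 'e set \<Rightarrow> 'a \<Rightarrow> 'e set \<Rightarrow> 'a" where
  "ext_incl R E p = (\<lambda>S\<in>Pow E. if S = {} then p else \<zero>\<^bsub>R\<^esub>)"

definition ext_gen :: "('a, 'm) ring_scheme \<Rightarrow> 'e set \<Rightarrow> 'e \<Rightarrow> 'e set \<Rightarrow> 'a" where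
  "ext_gen R E e = (\<lambda>S\<in>Pow E. if S = {e} then \<one>\<^bsub>R\<^esub> else \<zero>\<^bsub>R\<^esub>)"

text \<open>The \<open>R\<close>-linear graded derivation with \<open>g\<^sub>e \<mapsto> \<delta> e\<close>. On monomials it is
  \<open>g\<^sub>S \<mapsto> \<Sum>\<^bsub>e \<in> S\<^esub> (-1)^i (\<delta> e) g\<^bsub>S - {e}\<^esub>\<close>, with \<open>i\<close> the number of elements of \<open>S\<close> strictly below \<open>e\<close>;
  the definition gives the resulting coefficient at \<open>T = S - {e}\<close>.\<close>

definition ext_diff ::
    "('a, 'm) ring_scheme \<Rightarrow> 'e set \<Rightarrow> 'e rel \<Rightarrow> ('e \<Rightarrow> 'a) \<Rightarrow> ('e set \<Rightarrow> 'a) \<Rightarrow> 'e set \<Rightarrow> 'a" where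
  "ext_diff R E r \<delta> a =
     (\<lambda>T\<in>Pow E. \<Oplus>\<^bsub>R\<^esub>e\<in>E - T.
        sign_pow R (inversions r {e} T) \<otimes>\<^bsub>R\<^esub> (\<delta> e \<otimes>\<^bsub>R\<^esub> a (insert e T)))"

definition word_prod :: "('a, 'm) ring_scheme \<Rightarrow> 'a list \<Rightarrow> 'a" where
  "word_prod R xs = foldr (\<lambda>x y. x \<otimes>\<^bsub>R\<^esub> y) xs \<one>\<^bsub>R\<^esub>"

definition word_boundary :: "('a, 'm) ring_scheme \<Rightarrow> 'a list \<Rightarrow> 'a" where
  "word_boundary R xs =
     (\<Oplus>\<^bsub>R\<^esub>i\<in>{..<length xs}. sign_pow R i \<otimes>\<^bsub>R\<^esub> word_prod R (take i xs @ drop (Suc i) xs))"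


section \<open>The truncated polynomial ring and the algebra R\<close>

definition trunc_ideal :: "'v set \<Rightarrow> nat \<Rightarrow> 'v rpoly set" where
  "trunc_ideal V n = Idl\<^bsub>poly_ring V\<^esub> {hvar v ^ n | v. v \<in> V}"

definition trunc_ring :: "'v set \<Rightarrow> nat \<Rightarrow> 'v rpoly set ring" where
  "trunc_ring V n = poly_ring V Quot trunc_ideal V n"

definition trunc_class :: "'v set \<Rightarrow> nat \<Rightarrow> 'v rpoly \<Rightarrow> 'v rpoly set" where
  "trunc_class V n p = trunc_ideal V n +>\<^bsub>poly_ring V\<^esub> p"

definition trunc_deg :: "'v set \<Rightarrow> nat \<Rightarrow> int \<Rightarrow> 'v rpoly set set" where
  "trunc_deg V n k = {trunc_class V n p | p. p \<in> carrier (poly_ring V) \<and> poly_homogeneous k p}"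

definition R_ideal :: "'v set \<Rightarrow> 'v set set \<Rightarrow> nat \<Rightarrow> 'v rpoly set" where
  "R_ideal V E n =
     Idl\<^bsub>poly_ring V\<^esub> ({hvar v ^ n | v. v \<in> V} \<union> {Delta n u v | u v. {u, v} \<in> E})"

definition R_alg :: "'v set \<Rightarrow> 'v set set \<Rightarrow> nat \<Rightarrow> 'v rpoly set ring" where
  "R_alg V E n = poly_ring V Quot R_ideal V E n"

definition R_class :: "'v set \<Rightarrow> 'v set set \<Rightarrow> nat \<Rightarrow> 'v rpoly \<Rightarrow> 'v rpoly set" where
  "R_class V E n p = R_ideal V E n +>\<^bsub>poly_ring V\<^esub> p"

definition R_deg :: "'v set \<Rightarrow> 'v set set \<Rightarrow> nat \<Rightarrow> int \<Rightarrow> 'v rpoly set set" where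
  "R_deg V E n k = {R_class V E n p | p. p \<in> carrier (poly_ring V) \<and> poly_homogeneous k p}"


section \<open>The differential graded algebra K\<close>

type_synonym 'v kext = "'v set set \<Rightarrow> 'v rpoly set"

text \<open>Some linear order of the edges. It only serves to write down the basis of the exterior
  algebra.\<close>

definition edge_order :: "'v set set \<Rightarrow> 'v set rel" where
  "edge_order E = (SOME r. linear_order_on E r)"

definition K_ext :: "'v set \<Rightarrow> 'v set set \<Rightarrow> nat \<Rightarrow> 'v kext ring" where
  "K_ext V E n = ext_alg (trunc_ring V n) E (edge_order E)"

definition K_h :: "'v set \<Rightarrow> 'v set set \<Rightarrow> nat \<Rightarrow> 'v \<Rightarrow> 'v kext" where
  "K_h V E n v = ext_incl (trunc_ring V n) E (trunc_class V n (hvar v))"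

definition K_g :: "'v set \<Rightarrow> 'v set set \<Rightarrow> nat \<Rightarrow> 'v set \<Rightarrow> 'v kext" where
  "K_g V E n e = ext_gen (trunc_ring V n) E e"

definition J_ideal :: "'v set \<Rightarrow> 'v set set \<Rightarrow> nat \<Rightarrow> 'v kext set" where
  "J_ideal V E n =
     Idl\<^bsub>K_ext V E n\<^esub>
       ({(K_h V E n u \<ominus>\<^bsub>K_ext V E n\<^esub> K_h V E n v) \<otimes>\<^bsub>K_ext V E n\<^esub> K_g V E n {u, v} | u v. {u, v} \<in> E}
        \<union> {word_boundary (K_ext V E n) (map (K_g V E n) es) | es. simple_cycle E es})"

definition K_alg :: "'v set \<Rightarrow> 'v set set \<Rightarrow> nat \<Rightarrow> 'v kext set ring" where
  "K_alg V E n = K_ext V E n Quot J_ideal V E n"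

definition K_class :: "'v set \<Rightarrow> 'v set set \<Rightarrow> nat \<Rightarrow> 'v kext \<Rightarrow> 'v kext set" where
  "K_class V E n a = J_ideal V E n +>\<^bsub>K_ext V E n\<^esub> a"

definition K_incl :: "'v set \<Rightarrow> 'v set set \<Rightarrow> nat \<Rightarrow> 'v rpoly set \<Rightarrow> 'v kext set" where
  "K_incl V E n q = K_class V E n (ext_incl (trunc_ring V n) E q)"

definition K_ext_diff :: "'v set \<Rightarrow> 'v set set \<Rightarrow> nat \<Rightarrow> 'v kext \<Rightarrow> 'v kext" where
  "K_ext_diff V E n =
     ext_diff (trunc_ring V n) E (edge_order E) (\<lambda>e. trunc_class V n (edge_Delta n e))"

text \<open>The derivation maps \<open>J_ideal\<close> to itself, so all the cosets in the union are equal to the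
  coset of the differential of any representative of \<open>X\<close>.\<close>

definition K_diff :: "'v set \<Rightarrow> 'v set set \<Rightarrow> nat \<Rightarrow> 'v kext set \<Rightarrow> 'v kext set" where
  "K_diff V E n X = (\<Union>a\<in>X. K_class V E n (K_ext_diff V E n a))"

text \<open>Total degree, with \<open>|g\<^sub>e| = 2n - 3\<close>.\<close>

definition K_deg :: "'v set \<Rightarrow> 'v set set \<Rightarrow> nat \<Rightarrow> int \<Rightarrow> 'v kext set set" where
  "K_deg V E n k =
     {K_class V E n a | a. a \<in> carrier (K_ext V E n) \<and>
        (\<forall>S\<in>Pow E. a S \<in> trunc_deg V n (k - (2 * int n - 3) * int (card S)))}"

definition K_gdeg :: "'v set \<Rightarrow> 'v set set \<Rightarrow> nat \<Rightarrow> nat \<Rightarrow> 'v kext set set" where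
  "K_gdeg V E n i =
     {K_class V E n a | a. a \<in> carrier (K_ext V E n) \<and>
        (\<forall>S\<in>Pow E. card S \<noteq> i \<longrightarrow> a S = \<zero>\<^bsub>trunc_ring V n\<^esub>)}"


section \<open>Cohomology\<close>

definition K_cocycles :: "'v set \<Rightarrow> 'v set set \<Rightarrow> nat \<Rightarrow> 'v kext set set" where
  "K_cocycles V E n = {X \<in> carrier (K_alg V E n). K_diff V E n X = \<zero>\<^bsub>K_alg V E n\<^esub>}"

definition K_coboundaries :: "'v set \<Rightarrow> 'v set set \<Rightarrow> nat \<Rightarrow> 'v kext set set" where
  "K_coboundaries V E n = K_diff V E n ` carrier (K_alg V E n)"

definition K_cocycle_ring :: "'v set \<Rightarrow> 'v set set \<Rightarrow> nat \<Rightarrow> 'v kext set ring" where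
  "K_cocycle_ring V E n = (K_alg V E n)\<lparr>carrier := K_cocycles V E n\<rparr>"

definition H_alg :: "'v set \<Rightarrow> 'v set set \<Rightarrow> nat \<Rightarrow> 'v kext set set ring" where
  "H_alg V E n = K_cocycle_ring V E n Quot K_coboundaries V E n"

definition H_class :: "'v set \<Rightarrow> 'v set set \<Rightarrow> nat \<Rightarrow> 'v kext set \<Rightarrow> 'v kext set set" where
  "H_class V E n X = K_coboundaries V E n +>\<^bsub>K_cocycle_ring V E n\<^esub> X"

definition H_deg :: "'v set \<Rightarrow> 'v set set \<Rightarrow> nat \<Rightarrow> int \<Rightarrow> 'v kext set set set" where
  "H_deg V E n k = {H_class V E n X | X. X \<in> K_cocycles V E n \<inter> K_deg V E n k}"


section \<open>Homomorphisms of graded algebras\<close>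

text \<open>A graded \<open>\<rat>\<close>-algebra is a ring \<open>A\<close> with its structure map \<open>u :: rat \<Rightarrow> _\<close> and its family \<open>D\<close> of
  homogeneous components.\<close>

definition graded_alg_hom ::
    "('a, 'm) ring_scheme \<Rightarrow> (rat \<Rightarrow> 'a) \<Rightarrow> (int \<Rightarrow> 'a set) \<Rightarrow>
     ('b, 'n) ring_scheme \<Rightarrow> (rat \<Rightarrow> 'b) \<Rightarrow> (int \<Rightarrow> 'b set) \<Rightarrow> ('a \<Rightarrow> 'b) \<Rightarrow> bool" where
  "graded_alg_hom A u D A' u' D' f \<longleftrightarrow>
     ring_hom_ring A A' f \<and> (\<forall>c. f (u c) = u' c) \<and> (\<forall>k. f ` D k \<subseteq> D' k)"

definition R_unit :: "'v set \<Rightarrow> 'v set set \<Rightarrow> nat \<Rightarrow> rat \<Rightarrow> 'v rpoly set" where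
  "R_unit V E n c = R_class V E n (poly_const c)"

definition H_unit :: "'v set \<Rightarrow> 'v set set \<Rightarrow> nat \<Rightarrow> rat \<Rightarrow> 'v kext set set" where
  "H_unit V E n c = H_class V E n (K_incl V E n (trunc_class V n (poly_const c)))"

end

theory Submission
  imports Defs "HOL-Algebra.Subrings"
begin

text \<open>Let \<open>J\<close> be the ideal of the relations. A polynomial has \<open>g\<close>-degree zero, and its class in the
quotient by \<open>J\<close> is a cocycle, so polynomials map to cohomology. The theorem says that the kernel
of this map is the ideal generated by the \<open>h\<^sub>v ^ n\<close> and the \<open>\<Delta>\<^bsub>uv\<^esub>\<close>, and it rests on two
properties of \<open>J\<close>.

First, \<open>J\<close> has no element of \<open>g\<close>-degree zero other than zero (\<open>J_coeff_empty\<close>): the edge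
relations have \<open>g\<close>-degree one and the boundary of a cycle with \<open>k \<ge> 3\<close> edges has \<open>g\<close>-degree
\<open>k - 1\<close>. If the class of a polynomial \<open>p\<close> is a coboundary, then \<open>p - d a\<close> lies in \<open>J\<close> for some
\<open>a\<close>, and its component of \<open>g\<close>-degree zero reads \<open>p = \<Sum>\<^sub>e \<Delta>\<^sub>e a\<^sub>e\<close> with \<open>a\<^sub>e\<close> the coefficient of
\<open>g\<^sub>e\<close> in \<open>a\<close>. So \<open>p\<close> lies in the ideal that defines \<open>R\<close>. Conversely \<open>\<Delta>\<^sub>e = d g\<^sub>e\<close> is a
coboundary. This is \<open>kernel_H_poly\<close>.

Second, \<open>J\<close> is stable under the differential (\<open>diff_J\<close>); only then do the quotient by \<open>J\<close> and
its cohomology make sense. For an edge relation, \<open>(h\<^sub>u - h\<^sub>v) \<Delta>\<^bsub>uv\<^esub> = h\<^sub>u ^ n - h\<^sub>v ^ n\<close>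
vanishes in the truncated ring. For a cycle, the differential of the boundary is a signed sum,
over pairs of edges \<open>e\<close>, \<open>f\<close> of the cycle, of \<open>(\<Delta>\<^sub>f - \<Delta>\<^sub>e) w\<close> with \<open>w\<close> the product of the
generators of all other edges (\<open>d_boundary_in_subgroup\<close>). Deleting \<open>e\<close> and \<open>f\<close> leaves two arcs.
Modulo \<open>J\<close>, multiplication by \<open>w\<close> identifies the variables along each arc; as \<open>e\<close> and \<open>f\<close> both
join one arc to the other, it identifies \<open>\<Delta>\<^sub>e\<close> with \<open>\<Delta>\<^sub>f\<close> (\<open>cycle_two_edges\<close>).

The remaining work is to see that the exterior algebra, written in coordinates, is an
associative ring on which the differential is a derivation twisted by the parity involution and
squares to zero (\<open>ext_assoc\<close>, \<open>diff_leibniz\<close>, \<open>diff_diff\<close>). Everything about quotients and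
cohomology follows from these identities alone, so it is done once for an abstract ring with
such operators.\<close>

section \<open>Differential rings with a parity involution\<close>

lemma (in ring) additive_subgroupI_closed:
  assumes "I \<subseteq> carrier R" "\<zero> \<in> I" "\<And>x. x \<in> I \<Longrightarrow> \<ominus> x \<in> I"
    and "\<And>x y. \<lbrakk>x \<in> I; y \<in> I\<rbrakk> \<Longrightarrow> x \<oplus> y \<in> I"
  shows "additive_subgroup I R"
proof (rule additive_subgroup.intro, rule add.subgroupI)
  show "I \<subseteq> carrier R" "I \<noteq> {}" using assms by auto
qed (use assms in \<open>auto simp: a_inv_def\<close>)

text \<open>A ring with a differential and its parity involution \<open>s\<close>, which stands for \<open>a \<mapsto> (-1)^|a| a\<close>.
Keeping the sign as an operator lets the Leibniz rule hold for all elements, so that no grading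
has to be carried through quotients and subrings.\<close>

locale dg_ring = ring A for A (structure) +
  fixes s d :: "'a \<Rightarrow> 'a"
  assumes s_hom: "s \<in> ring_hom A A"
    and s_s: "x \<in> carrier A \<Longrightarrow> s (s x) = x"
    and d_closed [simp]: "x \<in> carrier A \<Longrightarrow> d x \<in> carrier A"
    and d_add: "\<lbrakk>x \<in> carrier A; y \<in> carrier A\<rbrakk> \<Longrightarrow> d (x \<oplus> y) = d x \<oplus> d y"
    and leibniz: "\<lbrakk>x \<in> carrier A; y \<in> carrier A\<rbrakk> \<Longrightarrow> d (x \<otimes> y) = d x \<otimes> y \<oplus> s x \<otimes> d y"
    and d_s: "x \<in> carrier A \<Longrightarrow> d (s x) = \<ominus> s (d x)"
    and d_d: "x \<in> carrier A \<Longrightarrow> d (d x) = \<zero>"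
begin

definition cocycles :: "'a set" where
  "cocycles = {x \<in> carrier A. d x = \<zero>}"

definition coboundaries :: "'a set" where
  "coboundaries = d ` carrier A"

lemma s_closed [simp]: "x \<in> carrier A \<Longrightarrow> s x \<in> carrier A"
  using s_hom by (rule ring_hom_closed)

lemma s_mult: "\<lbrakk>x \<in> carrier A; y \<in> carrier A\<rbrakk> \<Longrightarrow> s (x \<otimes> y) = s x \<otimes> s y"
  using s_hom by (rule ring_hom_mult)

lemma s_add: "\<lbrakk>x \<in> carrier A; y \<in> carrier A\<rbrakk> \<Longrightarrow> s (x \<oplus> y) = s x \<oplus> s y"
  using s_hom by (rule ring_hom_add)

lemma s_one [simp]: "s \<one> = \<one>"
  using s_hom by (rule ring_hom_one)

lemma d_zero [simp]: "d \<zero> = \<zero>"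
  using d_add[of \<zero> \<zero>] by (simp add: local.add.l_cancel_one)

lemma s_zero [simp]: "s \<zero> = \<zero>"
  using s_add[of \<zero> \<zero>] by (simp add: local.add.l_cancel_one)

lemma d_neg: "x \<in> carrier A \<Longrightarrow> d (\<ominus> x) = \<ominus> d x"
  using d_add[of "\<ominus> x" x] by (simp add: l_neg minus_equality[symmetric])

lemma s_neg: "x \<in> carrier A \<Longrightarrow> s (\<ominus> x) = \<ominus> s x"
  using s_add[of "\<ominus> x" x] by (simp add: l_neg minus_equality[symmetric])

lemma d_one [simp]: "d \<one> = \<zero>"
  using leibniz[of \<one> \<one>] by (simp add: local.add.l_cancel_one)

text \<open>Stability of a generated ideal has to be checked on generators for \<open>d\<close> and \<open>s\<close> together: the
elements of the ideal that \<open>d\<close> alone maps into the ideal need not form an ideal, as \<open>d (x a)\<close>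
contains the term \<open>s x (d a)\<close>.\<close>

lemma genideal_stable:
  assumes S: "S \<subseteq> carrier A"
    and d: "\<And>x. x \<in> S \<Longrightarrow> d x \<in> Idl S" and s: "\<And>x. x \<in> S \<Longrightarrow> s x \<in> Idl S"
    and x: "x \<in> Idl S"
  shows "d x \<in> Idl S" and "s x \<in> Idl S"
proof -
  interpret I: ideal "Idl S" A using S by (rule genideal_ideal)
  define J where "J = {x \<in> Idl S. d x \<in> Idl S \<and> s x \<in> Idl S}"
  have "ideal J A"
  proof (rule idealI[OF ring_axioms])
    have "additive_subgroup J A"
      by (rule additive_subgroupI_closed)
         (auto simp: J_def d_add s_add d_neg s_neg I.a_Hcarr I.a_inv_closed)
    then show "subgroup J (add_monoid A)" by (rule additive_subgroup.a_subgroup)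
    fix a x assume "a \<in> J" and x: "x \<in> carrier A"
    then have a: "a \<in> Idl S" "d a \<in> Idl S" "s a \<in> Idl S" "a \<in> carrier A"
      by (auto simp: J_def I.a_Hcarr)
    show "x \<otimes> a \<in> J" "a \<otimes> x \<in> J"
      using a x by (simp_all add: J_def leibniz s_mult I.a_closed I.I_l_closed I.I_r_closed)
  qed
  moreover have "S \<subseteq> J"
    using genideal_self[OF S] d s by (auto simp: J_def)
  ultimately have "Idl S \<subseteq> J" by (rule genideal_minimal)
  then show "d x \<in> Idl S" and "s x \<in> Idl S" using x by (auto simp: J_def)
qed

lemma cocycle_ring: "ring (A\<lparr>carrier := cocycles\<rparr>)"
proof (rule subring_is_ring, rule subringI)
  show "cocycles \<subseteq> carrier A" "\<one> \<in> cocycles" by (auto simp: cocycles_def)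
  show "\<ominus> x \<in> cocycles" if "x \<in> cocycles" for x
    using that by (simp add: cocycles_def d_neg)
  show "x \<otimes> y \<in> cocycles" "x \<oplus> y \<in> cocycles" if "x \<in> cocycles" "y \<in> cocycles" for x y
    using that by (simp_all add: cocycles_def leibniz d_add)
qed

text \<open>If \<open>d z = 0\<close>, then \<open>z (d a) = d (s z a)\<close> and \<open>(d a) z = d (a z)\<close>. The twist by \<open>s\<close> in the first
identity is what makes the coboundaries a left ideal even for cocycles of mixed parity.\<close>

lemma coboundaries_ideal: "ideal coboundaries (A\<lparr>carrier := cocycles\<rparr>)"
proof (rule ideal.intro)
  let ?Z = "A\<lparr>carrier := cocycles\<rparr>"
  show "ring ?Z" by (rule cocycle_ring)
  show "additive_subgroup coboundaries ?Z"
  proof (rule additive_subgroup.intro, rule group.subgroupI)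
    show "group (add_monoid ?Z)"
      using cocycle_ring abelian_group.a_group ring.is_abelian_group by blast
    show "coboundaries \<subseteq> carrier (add_monoid ?Z)"
      by (auto simp: coboundaries_def cocycles_def d_d)
    show "coboundaries \<noteq> {}" by (auto simp: coboundaries_def)
    fix x assume "x \<in> coboundaries"
    then obtain a where a: "a \<in> carrier A" "x = d a" by (auto simp: coboundaries_def)
    have "inv\<^bsub>add_monoid ?Z\<^esub> x = d (\<ominus> a)"
      using a by (intro group.inv_equality[OF \<open>group (add_monoid ?Z)\<close>])
                 (auto simp: cocycles_def d_d d_neg l_neg)
    then show "inv\<^bsub>add_monoid ?Z\<^esub> x \<in> coboundaries" using a by (auto simp: coboundaries_def)
  next
    fix x y assume "x \<in> coboundaries" "y \<in> coboundaries"
    then show "x \<otimes>\<^bsub>add_monoid ?Z\<^esub> y \<in> coboundaries"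
      by (auto simp: coboundaries_def simp flip: d_add)
  qed
  show "ideal_axioms coboundaries ?Z"
  proof
    fix b z assume "b \<in> coboundaries" and z: "z \<in> carrier ?Z"
    then obtain a where a: "a \<in> carrier A" "b = d a" by (auto simp: coboundaries_def)
    have z': "z \<in> carrier A" "d z = \<zero>" using z by (auto simp: cocycles_def)
    have "z \<otimes> b = d (s z \<otimes> a)" "b \<otimes> z = d (a \<otimes> z)"
      using a z' by (simp_all add: leibniz d_s s_s)
    then show "z \<otimes>\<^bsub>?Z\<^esub> b \<in> coboundaries" "b \<otimes>\<^bsub>?Z\<^esub> z \<in> coboundaries"
      using a z' by (auto simp: coboundaries_def)
  qed
qed

end

text \<open>The map on cosets that is induced by a map on elements. As a union over representatives it is a
total operation; it is a coset as soon as \<open>f\<close> is additive and preserves \<open>J\<close>.\<close>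

definition coset_map :: "('a, 'm) ring_scheme \<Rightarrow> 'a set \<Rightarrow> ('a \<Rightarrow> 'a) \<Rightarrow> 'a set \<Rightarrow> 'a set" where
  "coset_map A J f X = (\<Union>a\<in>X. J +>\<^bsub>A\<^esub> f a)"

lemma (in ideal) coset_map_coset:
  assumes x: "x \<in> carrier R" and f: "\<And>y. y \<in> carrier R \<Longrightarrow> f y \<in> carrier R"
    and add: "\<And>y z. \<lbrakk>y \<in> carrier R; z \<in> carrier R\<rbrakk> \<Longrightarrow> f (y \<oplus> z) = f y \<oplus> f z"
    and stable: "\<And>y. y \<in> I \<Longrightarrow> f y \<in> I"
  shows "coset_map R I f (I +> x) = I +> f x"
proof -
  have "I +> f y = I +> f x" if "y \<in> I +> x" for y
  proof -
    obtain i where i: "i \<in> I" "y = i \<oplus> x"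
      using \<open>y \<in> I +> x\<close> unfolding a_r_coset_def' by blast
    then have "f y = f i \<oplus> f x" using x by (simp add: add Icarr)
    then have "f y \<in> I +> f x" using stable[OF i(1)] by (auto simp: a_r_coset_def')
    then show ?thesis using a_repr_independence'[OF _ f[OF x]] by simp
  qed
  moreover have "x \<in> I +> x" using x by (rule a_rcos_self)
  ultimately show ?thesis unfolding coset_map_def by blast
qed

lemma (in dg_ring) quotient_dg_ring:
  assumes J: "ideal J A" and dJ: "\<And>x. x \<in> J \<Longrightarrow> d x \<in> J" and sJ: "\<And>x. x \<in> J \<Longrightarrow> s x \<in> J"
  shows "dg_ring (A Quot J) (coset_map A J s) (coset_map A J d)"
proof -
  interpret J: ideal J A by (rule J)
  interpret Q: ring "A Quot J" by (rule J.quotient_is_ring)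
  interpret q: ring_hom_ring A "A Quot J" "(+>) J" by (rule J.rcos_ring_hom_ring)
  have s: "coset_map A J s (J +> x) = J +> s x" if "x \<in> carrier A" for x
    using that by (intro J.coset_map_coset) (auto simp: s_add sJ)
  have d: "coset_map A J d (J +> x) = J +> d x" if "x \<in> carrier A" for x
    using that by (intro J.coset_map_coset) (auto simp: d_add dJ)
  have rep: "\<exists>x\<in>carrier A. X = J +> x" if "X \<in> carrier (A Quot J)" for X
    using that unfolding FactRing_def A_RCOSETS_def' by (simp only: ring_record_simps partial_object.select_convs) blast
  show ?thesis
  proof
    show "coset_map A J s \<in> ring_hom (A Quot J) (A Quot J)"
    proof (rule ring_hom_memI)
      fix X Y assume "X \<in> carrier (A Quot J)" "Y \<in> carrier (A Quot J)"
      then obtain x y where [simp]: "x \<in> carrier A" "X = J +> x" "y \<in> carrier A" "Y = J +> y"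
        using rep by metis
      show "coset_map A J s X \<in> carrier (A Quot J)" by (simp add: s)
      show "coset_map A J s (X \<otimes>\<^bsub>A Quot J\<^esub> Y)
          = coset_map A J s X \<otimes>\<^bsub>A Quot J\<^esub> coset_map A J s Y"
        by (simp add: s s_mult flip: q.hom_mult)
      show "coset_map A J s (X \<oplus>\<^bsub>A Quot J\<^esub> Y)
          = coset_map A J s X \<oplus>\<^bsub>A Quot J\<^esub> coset_map A J s Y"
        by (simp add: s s_add flip: q.hom_add)
    next
      show "coset_map A J s \<one>\<^bsub>A Quot J\<^esub> = \<one>\<^bsub>A Quot J\<^esub>"
        by (simp add: s flip: q.hom_one)
    qed
    fix X assume "X \<in> carrier (A Quot J)"
    then obtain x where x [simp]: "x \<in> carrier A" "X = J +> x" using rep by metis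
    show "coset_map A J s (coset_map A J s X) = X" by (simp add: s s_s)
    show "coset_map A J d X \<in> carrier (A Quot J)" by (simp add: d)
    show "coset_map A J d (coset_map A J s X) = \<ominus>\<^bsub>A Quot J\<^esub> coset_map A J s (coset_map A J d X)"
      by (simp add: s d d_s flip: q.hom_a_inv)
    show "coset_map A J d (coset_map A J d X) = \<zero>\<^bsub>A Quot J\<^esub>"
      by (simp add: d d_d flip: q.hom_zero)
    fix Y assume "Y \<in> carrier (A Quot J)"
    then obtain y where y [simp]: "y \<in> carrier A" "Y = J +> y" using rep by metis
    show "coset_map A J d (X \<oplus>\<^bsub>A Quot J\<^esub> Y)
        = coset_map A J d X \<oplus>\<^bsub>A Quot J\<^esub> coset_map A J d Y"
      by (simp add: d d_add flip: q.hom_add)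
    show "coset_map A J d (X \<otimes>\<^bsub>A Quot J\<^esub> Y)
        = coset_map A J d X \<otimes>\<^bsub>A Quot J\<^esub> Y \<oplus>\<^bsub>A Quot J\<^esub> coset_map A J s X \<otimes>\<^bsub>A Quot J\<^esub> coset_map A J d Y"
      by (simp add: d s leibniz flip: q.hom_mult q.hom_add)
  qed
qed

section \<open>Finite sums and signs\<close>

lemma (in abelian_monoid) finsum_swap:
  assumes "finite A" "finite B" "\<And>a b. \<lbrakk>a \<in> A; b \<in> B\<rbrakk> \<Longrightarrow> f a b \<in> carrier G"
  shows "(\<Oplus>a\<in>A. \<Oplus>b\<in>B. f a b) = (\<Oplus>b\<in>B. \<Oplus>a\<in>A. f a b)"
  using assms(1,3)
proof (induction A)
  case empty
  then show ?case by simp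
next
  case (insert x A)
  have "(\<Oplus>a\<in>insert x A. \<Oplus>b\<in>B. f a b) = (\<Oplus>b\<in>B. f x b) \<oplus> (\<Oplus>a\<in>A. \<Oplus>b\<in>B. f a b)"
    using insert by (intro finsum_insert) (auto intro!: finsum_closed)
  also have "\<dots> = (\<Oplus>b\<in>B. f x b) \<oplus> (\<Oplus>b\<in>B. \<Oplus>a\<in>A. f a b)"
    using insert by simp
  also have "\<dots> = (\<Oplus>b\<in>B. f x b \<oplus> (\<Oplus>a\<in>A. f a b))"
    using insert by (intro finsum_addf[symmetric]) (auto intro!: finsum_closed)
  also have "\<dots> = (\<Oplus>b\<in>B. \<Oplus>a\<in>insert x A. f a b)"
    using insert by (intro finsum_cong' refl) (auto intro!: finsum_closed finsum_insert[symmetric])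
  finally show ?case .
qed

lemma (in abelian_monoid) finsum_Sigma:
  assumes "finite A" "\<And>a. a \<in> A \<Longrightarrow> finite (B a)"
    and "\<And>a b. \<lbrakk>a \<in> A; b \<in> B a\<rbrakk> \<Longrightarrow> f a b \<in> carrier G"
  shows "(\<Oplus>a\<in>A. \<Oplus>b\<in>B a. f a b) = (\<Oplus>p\<in>Sigma A B. f (fst p) (snd p))"
  using assms
proof (induction A)
  case empty
  then show ?case by simp
next
  case (insert x A)
  have "(\<Oplus>p\<in>Pair x ` B x. f (fst p) (snd p)) = (\<Oplus>b\<in>B x. f x b)"
    using insert by (subst finsum_reindex) (auto simp: inj_on_def)
  moreover have "Sigma (insert x A) B = Pair x ` B x \<union> Sigma A B" by auto
  moreover have "(\<Oplus>p\<in>Pair x ` B x \<union> Sigma A B. f (fst p) (snd p))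
      = (\<Oplus>p\<in>Pair x ` B x. f (fst p) (snd p)) \<oplus> (\<Oplus>p\<in>Sigma A B. f (fst p) (snd p))"
    using insert by (intro finsum_Un_disjoint) auto
  moreover have "(\<Oplus>a\<in>insert x A. \<Oplus>b\<in>B a. f a b)
      = (\<Oplus>b\<in>B x. f x b) \<oplus> (\<Oplus>a\<in>A. \<Oplus>b\<in>B a. f a b)"
    using insert by (intro finsum_insert) (auto intro!: finsum_closed)
  ultimately show ?case using insert by simp
qed

text \<open>This splits a sum over subsets into pairs \<open>T\<close>, \<open>insert e T\<close>. Identities about the contraction
with \<open>e\<close> then hold pair by pair.\<close>

lemma (in abelian_monoid) finsum_Pow_insert:
  assumes "finite U" "e \<notin> U" "\<And>T. T \<subseteq> insert e U \<Longrightarrow> f T \<in> carrier G"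
  shows "(\<Oplus>T\<in>Pow (insert e U). f T) = (\<Oplus>T\<in>Pow U. f T \<oplus> f (insert e T))"
proof -
  have cl: "f T \<in> carrier G" "f (insert e T) \<in> carrier G" if "T \<subseteq> U" for T
    using assms(3) that by blast+
  have inj: "inj_on (insert e) (Pow U)" using assms(2) by (auto simp: inj_on_def)
  have "(\<Oplus>T\<in>Pow (insert e U). f T) = (\<Oplus>T\<in>Pow U. f T) \<oplus> (\<Oplus>T\<in>insert e ` Pow U. f T)"
    unfolding Pow_insert using assms(1,2) cl by (intro finsum_Un_disjoint) auto
  also have "(\<Oplus>T\<in>insert e ` Pow U. f T) = (\<Oplus>T\<in>Pow U. f (insert e T))"
    using cl inj by (intro finsum_reindex) auto
  also have "(\<Oplus>T\<in>Pow U. f T) \<oplus> \<dots> = (\<Oplus>T\<in>Pow U. f T \<oplus> f (insert e T))"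
    using cl by (intro finsum_addf[symmetric]) auto
  finally show ?thesis .
qed

text \<open>The vanishing of the diagonal is a separate hypothesis because the group may have elements of
order two. The induction on \<open>A\<close> cancels the row of the new element against its column.\<close>

lemma (in abelian_group) finsum_antisym:
  assumes "finite A" "\<And>a b. \<lbrakk>a \<in> A; b \<in> A\<rbrakk> \<Longrightarrow> f a b \<in> carrier G"
    and "\<And>a. a \<in> A \<Longrightarrow> f a a = \<zero>" "\<And>a b. \<lbrakk>a \<in> A; b \<in> A\<rbrakk> \<Longrightarrow> f b a = \<ominus> f a b"
  shows "(\<Oplus>a\<in>A. \<Oplus>b\<in>A. f a b) = \<zero>"
  using assms
proof (induction A)
  case empty
  show ?case by simp
next
  case (insert x A)
  have cl: "f a b \<in> carrier G" if "a \<in> insert x A" "b \<in> insert x A" for a b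
    using that by (rule insert.prems(1))
  have row: "(\<Oplus>b\<in>insert x A. f a b) = f a x \<oplus> (\<Oplus>b\<in>A. f a b)" if "a \<in> insert x A" for a
    using insert.hyps cl that by (intro finsum_insert) auto
  have "(\<Oplus>a\<in>insert x A. \<Oplus>b\<in>insert x A. f a b)
      = (\<Oplus>a\<in>insert x A. f a x \<oplus> (\<Oplus>b\<in>A. f a b))"
    using cl by (intro finsum_cong' refl) (auto simp: row intro!: finsum_closed a_closed)
  also have "\<dots> = (f x x \<oplus> (\<Oplus>b\<in>A. f x b)) \<oplus> (\<Oplus>a\<in>A. f a x \<oplus> (\<Oplus>b\<in>A. f a b))"
    using insert.hyps cl by (intro finsum_insert) (auto intro!: finsum_closed a_closed)
  also have "(\<Oplus>a\<in>A. f a x \<oplus> (\<Oplus>b\<in>A. f a b)) = (\<Oplus>a\<in>A. f a x) \<oplus> (\<Oplus>a\<in>A. \<Oplus>b\<in>A. f a b)"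
    using cl by (intro finsum_addf) (auto intro!: finsum_closed)
  also have "(\<Oplus>a\<in>A. \<Oplus>b\<in>A. f a b) = \<zero>"
    using insert.prems by (intro insert.IH) blast+
  finally have "(\<Oplus>a\<in>insert x A. \<Oplus>b\<in>insert x A. f a b) = (\<Oplus>b\<in>A. f x b) \<oplus> (\<Oplus>a\<in>A. f a x)"
    using insert.prems(2) cl by (simp add: Pi_def)
  also have "\<dots> = (\<Oplus>b\<in>A. f x b \<oplus> f b x)"
    using cl by (intro finsum_addf[symmetric]) auto
  also have "\<dots> = \<zero>"
    using cl by (intro add.finprod_one_eqI) (simp add: insert.prems(3)[of x] r_neg)
  finally show ?case .
qed

lemma ideal_finsum:
  assumes "ideal I R" and "\<And>i. i \<in> A \<Longrightarrow> f i \<in> I"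
  shows "finsum R f A \<in> I"
proof -
  interpret ideal I R by (rule assms(1))
  show ?thesis using assms(2)
  proof (induction A rule: infinite_finite_induct)
    case (insert x A)
    then show ?case using a_Hcarr by (subst finsum_insert) auto
  qed auto
qed

context ring
begin

lemma sign_pow_closed [simp]: "sign_pow R i \<in> carrier R"
  by (simp add: sign_pow_def)

lemma sign_pow_0 [simp]: "sign_pow R 0 = \<one>"
  by (simp add: sign_pow_def)

lemma sign_pow_Suc: "sign_pow R (Suc i) = \<ominus> sign_pow R i"
  by (simp add: sign_pow_def r_minus)

lemma sign_pow_add: "sign_pow R (i + j) = sign_pow R i \<otimes> sign_pow R j"
  by (simp add: sign_pow_def nat_pow_mult)

lemma sign_pow_commute: "x \<in> carrier R \<Longrightarrow> sign_pow R i \<otimes> x = x \<otimes> sign_pow R i"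
  by (induction i) (auto simp: sign_pow_Suc l_minus r_minus)

lemma sign_pow_square [simp]: "sign_pow R i \<otimes> sign_pow R i = \<one>"
  by (induction i) (auto simp: sign_pow_Suc l_minus r_minus)

end

section \<open>Exterior algebras over a commutative ring\<close>

locale exterior_algebra = cring R for R (structure) +
  fixes E :: "'e set" and r :: "'e rel"
  assumes finite_E: "finite E" and linear: "linear_order_on E r"
begin

abbreviation ext where "ext \<equiv> ext_alg R E r"

text \<open>The sign in \<open>g\<^sub>S g\<^sub>T = \<plusminus> g\<^bsub>S \<union> T\<^esub>\<close> for disjoint \<open>S\<close> and \<open>T\<close>. Sign computations below rest on its
multiplicativity in both arguments, on its square being one, and on \<open>shuffle_sign_swap\<close>.\<close>

definition shuffle_sign :: "'e set \<Rightarrow> 'e set \<Rightarrow> 'a" where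
  "shuffle_sign S T = sign_pow R (inversions r S T)"

definition parity_sign :: "'e set \<Rightarrow> 'a" where
  "parity_sign S = sign_pow R (card S)"

lemma shuffle_sign_closed [simp]: "shuffle_sign S T \<in> carrier R"
  by (simp add: shuffle_sign_def)

lemma parity_sign_closed [simp]: "parity_sign S \<in> carrier R"
  by (simp add: parity_sign_def)

lemma shuffle_sign_cancel [simp]: "x \<in> carrier R \<Longrightarrow> shuffle_sign S T \<otimes> (shuffle_sign S T \<otimes> x) = x"
  by (simp add: shuffle_sign_def flip: m_assoc)

lemma parity_sign_cancel [simp]: "x \<in> carrier R \<Longrightarrow> parity_sign S \<otimes> (parity_sign S \<otimes> x) = x"
  by (simp add: parity_sign_def flip: m_assoc)

lemma finite_sub [simp]: "S \<subseteq> E \<Longrightarrow> finite S"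
  using finite_E by (rule rev_finite_subset)

lemma parity_sign_empty [simp]: "parity_sign {} = \<one>"
  by (simp add: parity_sign_def)

lemma parity_sign_insert: "\<lbrakk>S \<subseteq> E; e \<notin> S\<rbrakk> \<Longrightarrow> parity_sign (insert e S) = \<ominus> parity_sign S"
  by (simp add: parity_sign_def sign_pow_Suc)

lemma parity_sign_Un: "\<lbrakk>S \<subseteq> E; T \<subseteq> E; S \<inter> T = {}\<rbrakk> \<Longrightarrow> parity_sign (S \<union> T) = parity_sign S \<otimes> parity_sign T"
  by (simp add: parity_sign_def card_Un_disjoint sign_pow_add)

lemma shuffle_sign_empty [simp]: "shuffle_sign {} T = \<one>" "shuffle_sign S {} = \<one>"
  by (simp_all add: shuffle_sign_def inversions_def)

lemma shuffle_sign_Un_left: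
  assumes "S \<subseteq> E" "T \<subseteq> E" "U \<subseteq> E" "S \<inter> T = {}"
  shows "shuffle_sign (S \<union> T) U = shuffle_sign S U \<otimes> shuffle_sign T U"
proof -
  have eq: "{(s, t) \<in> (S \<union> T) \<times> U. (t, s) \<in> r}
      = {(s, t) \<in> S \<times> U. (t, s) \<in> r} \<union> {(s, t) \<in> T \<times> U. (t, s) \<in> r}" by auto
  have "inversions r (S \<union> T) U = inversions r S U + inversions r T U"
    unfolding inversions_def eq using assms
    by (intro card_Un_disjoint) (auto intro: finite_subset[OF _ finite_cartesian_product])
  then show ?thesis by (simp add: shuffle_sign_def sign_pow_add)
qed

lemma shuffle_sign_Un_right:
  assumes "S \<subseteq> E" "T \<subseteq> E" "U \<subseteq> E" "S \<inter> T = {}"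
  shows "shuffle_sign U (S \<union> T) = shuffle_sign U S \<otimes> shuffle_sign U T"
proof -
  have eq: "{(s, t) \<in> U \<times> (S \<union> T). (t, s) \<in> r}
      = {(s, t) \<in> U \<times> S. (t, s) \<in> r} \<union> {(s, t) \<in> U \<times> T. (t, s) \<in> r}" by auto
  have "inversions r U (S \<union> T) = inversions r U S + inversions r U T"
    unfolding inversions_def eq using assms
    by (intro card_Un_disjoint) (auto intro: finite_subset[OF _ finite_cartesian_product])
  then show ?thesis by (simp add: shuffle_sign_def sign_pow_add)
qed

lemma shuffle_sign_insert_left:
  "\<lbrakk>e \<in> E; T \<subseteq> E; U \<subseteq> E; e \<notin> T\<rbrakk> \<Longrightarrow> shuffle_sign (insert e T) U = shuffle_sign {e} U \<otimes> shuffle_sign T U"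
  using shuffle_sign_Un_left[of "{e}" T U] by simp

lemma shuffle_sign_insert_right:
  "\<lbrakk>e \<in> E; T \<subseteq> E; U \<subseteq> E; e \<notin> T\<rbrakk> \<Longrightarrow> shuffle_sign U (insert e T) = shuffle_sign U {e} \<otimes> shuffle_sign U T"
  using shuffle_sign_Un_right[of "{e}" T U] by simp

lemma shuffle_sign_singletons:
  assumes "e \<in> E" "f \<in> E" "e \<noteq> f"
  shows "shuffle_sign {e} {f} = \<ominus> shuffle_sign {f} {e}"
proof -
  have inv: "inversions r {a} {b} = (if (b, a) \<in> r then 1 else 0)" for a b
  proof -
    have "{(s, t) \<in> {a} \<times> {b}. (t, s) \<in> r} = (if (b, a) \<in> r then {(a, b)} else {})" by auto
    then show ?thesis by (simp add: inversions_def)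
  qed
  have "((e, f) \<in> r) \<noteq> ((f, e) \<in> r)"
    using linear assms
    by (auto simp: linear_order_on_def partial_order_on_def total_on_def antisym_def)
  then show ?thesis by (auto simp: shuffle_sign_def inv sign_pow_Suc)
qed

text \<open>Exactly one of the pairs \<open>(e, t)\<close>, \<open>(t, e)\<close> is an inversion for each \<open>t \<in> T\<close>: moving \<open>g\<^sub>e\<close> past
\<open>g\<^sub>T\<close> costs \<open>(-1)^|T|\<close>.\<close>

lemma shuffle_sign_swap:
  assumes "e \<in> E" "T \<subseteq> E" "e \<notin> T"
  shows "shuffle_sign {e} T \<otimes> shuffle_sign T {e} = parity_sign T"
proof -
  have "finite T" using assms by simp
  then show ?thesis using assms
  proof (induction T)
    case empty
    then show ?case by simp
  next
    case (insert f T)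
    have "shuffle_sign {e} (insert f T) \<otimes> shuffle_sign (insert f T) {e}
       = (shuffle_sign {e} {f} \<otimes> shuffle_sign {f} {e}) \<otimes> (shuffle_sign {e} T \<otimes> shuffle_sign T {e})"
      using insert.prems insert.hyps
      by (simp add: shuffle_sign_insert_left[of f T "{e}"] shuffle_sign_insert_right[of f T "{e}"] m_ac)
    also have "shuffle_sign {e} {f} \<otimes> shuffle_sign {f} {e} = \<ominus> \<one>"
      using insert.prems insert.hyps by (subst shuffle_sign_singletons) (auto simp: l_minus shuffle_sign_def)
    finally show ?case using insert by (simp add: parity_sign_insert l_minus)
  qed
qed

lemma ext_carrier: "carrier ext = (Pow E \<rightarrow>\<^sub>E carrier R)"
  by (simp add: ext_alg_def)

lemma ext_coeff [simp]: "\<lbrakk>a \<in> carrier ext; S \<subseteq> E\<rbrakk> \<Longrightarrow> a S \<in> carrier R"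
  by (auto simp: ext_carrier)

lemma ext_coeff_Diff [simp]: "\<lbrakk>a \<in> carrier ext; S \<subseteq> E\<rbrakk> \<Longrightarrow> a (S - T) \<in> carrier R"
  by (rule ext_coeff) auto

lemma ext_eqI:
  assumes "a \<in> carrier ext" "b \<in> carrier ext" "\<And>S. S \<subseteq> E \<Longrightarrow> a S = b S"
  shows "a = b"
  using assms by (auto simp: ext_carrier intro!: PiE_ext[of a "Pow E" _ b])

lemma ext_carrierI: "(\<And>S. S \<subseteq> E \<Longrightarrow> f S \<in> carrier R) \<Longrightarrow> (\<lambda>S\<in>Pow E. f S) \<in> carrier ext"
  by (auto simp: ext_carrier)

lemma ext_zero: "S \<subseteq> E \<Longrightarrow> \<zero>\<^bsub>ext\<^esub> S = \<zero>"
  by (simp add: ext_alg_def)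

lemma ext_add: "S \<subseteq> E \<Longrightarrow> (a \<oplus>\<^bsub>ext\<^esub> b) S = a S \<oplus> b S"
  by (simp add: ext_alg_def)

lemma ext_mult:
  "S \<subseteq> E \<Longrightarrow> (a \<otimes>\<^bsub>ext\<^esub> b) S = (\<Oplus>T\<in>Pow S. shuffle_sign T (S - T) \<otimes> (a T \<otimes> b (S - T)))"
  by (simp add: ext_alg_def shuffle_sign_def)

lemma ext_incl_closed [simp]: "p \<in> carrier R \<Longrightarrow> ext_incl R E p \<in> carrier ext"
  unfolding ext_incl_def by (rule ext_carrierI) simp

lemma ext_incl_coeff: "S \<subseteq> E \<Longrightarrow> ext_incl R E p S = (if S = {} then p else \<zero>)"
  by (simp add: ext_incl_def)

lemma ext_one: "\<one>\<^bsub>ext\<^esub> = ext_incl R E \<one>"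
  by (simp add: ext_alg_def ext_incl_def)

lemma ext_zero_closed: "\<zero>\<^bsub>ext\<^esub> \<in> carrier ext"
  by (simp add: ext_alg_def)

lemma ext_add_closed: "\<lbrakk>a \<in> carrier ext; b \<in> carrier ext\<rbrakk> \<Longrightarrow> a \<oplus>\<^bsub>ext\<^esub> b \<in> carrier ext"
  unfolding ext_alg_def by (auto simp: ext_carrier[unfolded ext_alg_def])

lemma ext_mult_closed:
  assumes "a \<in> carrier ext" "b \<in> carrier ext"
  shows "a \<otimes>\<^bsub>ext\<^esub> b \<in> carrier ext"
proof -
  have "(\<lambda>S\<in>Pow E. (a \<otimes>\<^bsub>ext\<^esub> b) S) \<in> carrier ext"
    using assms by (intro ext_carrierI) (auto simp: ext_mult subset_trans intro!: finsum_closed)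
  moreover have "(\<lambda>S\<in>Pow E. (a \<otimes>\<^bsub>ext\<^esub> b) S) = a \<otimes>\<^bsub>ext\<^esub> b"
    by (auto simp: ext_alg_def)
  ultimately show ?thesis by simp
qed

lemma ext_incl_mult:
  assumes "p \<in> carrier R" "a \<in> carrier ext" "S \<subseteq> E"
  shows "(ext_incl R E p \<otimes>\<^bsub>ext\<^esub> a) S = p \<otimes> a S" "(a \<otimes>\<^bsub>ext\<^esub> ext_incl R E p) S = p \<otimes> a S"
proof -
  have "(ext_incl R E p \<otimes>\<^bsub>ext\<^esub> a) S = (\<Oplus>T\<in>Pow S. if {} = T then p \<otimes> a (S - T) else \<zero>)"
    unfolding ext_mult[OF assms(3)] using assms
    by (intro finsum_cong' refl) (simp_all add: ext_incl_coeff subset_trans[OF _ assms(3)])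
  also have "\<dots> = p \<otimes> a S"
    using assms by (subst finsum_singleton) auto
  finally show "(ext_incl R E p \<otimes>\<^bsub>ext\<^esub> a) S = p \<otimes> a S" .
  have "S - T = {} \<longleftrightarrow> S = T" if "T \<subseteq> S" for T using that by auto
  then have "(a \<otimes>\<^bsub>ext\<^esub> ext_incl R E p) S = (\<Oplus>T\<in>Pow S. if S = T then p \<otimes> a T else \<zero>)"
    unfolding ext_mult[OF assms(3)] using assms
    by (intro finsum_cong' refl) (auto simp: ext_incl_coeff subset_trans[OF _ assms(3)] m_comm)
  also have "\<dots> = p \<otimes> a S"
    using assms by (subst finsum_singleton) auto
  finally show "(a \<otimes>\<^bsub>ext\<^esub> ext_incl R E p) S = p \<otimes> a S" .
qed

text \<open>Both sides are sums over the decompositions of \<open>S\<close> into three disjoint parts. On the left the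
decomposition is indexed by \<open>X = T \<union> U\<close> and \<open>T\<close>, on the right by \<open>T\<close> and \<open>U\<close>; multiplicativity
of the signs makes the terms agree.\<close>

lemma ext_assoc:
  assumes "a \<in> carrier ext" "b \<in> carrier ext" "c \<in> carrier ext"
  shows "(a \<otimes>\<^bsub>ext\<^esub> b) \<otimes>\<^bsub>ext\<^esub> c = a \<otimes>\<^bsub>ext\<^esub> (b \<otimes>\<^bsub>ext\<^esub> c)"
proof (rule ext_eqI)
  fix S assume S: "S \<subseteq> E"
  define f where "f X T = shuffle_sign X (S - X) \<otimes> shuffle_sign T (X - T) \<otimes> (a T \<otimes> b (X - T) \<otimes> c (S - X))" for X T
  define g where "g T U = shuffle_sign T (S - T) \<otimes> shuffle_sign U (S - T - U) \<otimes> (a T \<otimes> b U \<otimes> c (S - T - U))" for T U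
  have f_closed: "f X T \<in> carrier R" if "X \<subseteq> S" "T \<subseteq> X" for X T
  proof -
    have "T \<subseteq> E" "X - T \<subseteq> E" "S - X \<subseteq> E" using that S by auto
    then show ?thesis using assms by (simp add: f_def)
  qed
  have g_closed: "g T U \<in> carrier R" if "T \<subseteq> S" "U \<subseteq> S - T" for T U
  proof -
    have "T \<subseteq> E" "U \<subseteq> E" "S - T - U \<subseteq> E" using that S by auto
    then show ?thesis using assms by (simp add: g_def)
  qed
  have fg: "f (T \<union> U) T = g T U" if "T \<subseteq> S" "U \<subseteq> S - T" for T U
  proof -
    have "T \<subseteq> E" "U \<subseteq> E" "S - T - U \<subseteq> E" "T \<inter> U = {}" using that S by auto
    moreover have "T \<union> U - T = U" "S - (T \<union> U) = S - T - U" using that by auto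
    moreover have "shuffle_sign T (S - T) = shuffle_sign T U \<otimes> shuffle_sign T (S - T - U)"
      using shuffle_sign_Un_right[of U "S - T - U" T] calculation that by (simp add: Un_absorb1)
    ultimately show ?thesis using assms
      by (simp add: f_def g_def shuffle_sign_Un_left m_ac)
  qed
  have "((a \<otimes>\<^bsub>ext\<^esub> b) \<otimes>\<^bsub>ext\<^esub> c) S = (\<Oplus>X\<in>Pow S. \<Oplus>T\<in>Pow X. f X T)"
    unfolding ext_mult[OF S]
  proof (intro finsum_cong' refl)
    fix X assume "X \<in> Pow S"
    then have X: "X \<subseteq> E" "S - X \<subseteq> E" "X \<subseteq> S" using S by auto
    have X': "\<And>T. T \<subseteq> X \<Longrightarrow> T \<subseteq> E" using X by auto
    have "shuffle_sign X (S - X) \<otimes> ((a \<otimes>\<^bsub>ext\<^esub> b) X \<otimes> c (S - X))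
       = (shuffle_sign X (S - X) \<otimes> c (S - X)) \<otimes> (\<Oplus>T\<in>Pow X. shuffle_sign T (X - T) \<otimes> (a T \<otimes> b (X - T)))"
      using X X' assms by (simp add: ext_mult m_ac finsum_closed Pi_def)
    also have "\<dots> = (\<Oplus>T\<in>Pow X. (shuffle_sign X (S - X) \<otimes> c (S - X)) \<otimes> (shuffle_sign T (X - T) \<otimes> (a T \<otimes> b (X - T))))"
      using X X' assms by (intro finsum_rdistr) auto
    also have "\<dots> = (\<Oplus>T\<in>Pow X. f X T)"
      using X X' assms f_closed by (intro finsum_cong' refl) (auto simp: f_def m_ac)
    finally show "shuffle_sign X (S - X) \<otimes> ((a \<otimes>\<^bsub>ext\<^esub> b) X \<otimes> c (S - X)) = (\<Oplus>T\<in>Pow X. f X T)" .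
  qed (use f_closed in \<open>auto intro!: finsum_closed\<close>)
  also have "\<dots> = (\<Oplus>p\<in>Sigma (Pow S) Pow. f (fst p) (snd p))"
    using S f_closed by (intro finsum_Sigma) (auto dest: subset_trans)
  also have "Sigma (Pow S) Pow = (\<lambda>(T, U). (T \<union> U, T)) ` Sigma (Pow S) (\<lambda>T. Pow (S - T))"
  proof (intro equalityI subsetI)
    fix p assume "p \<in> Sigma (Pow S) Pow"
    then show "p \<in> (\<lambda>(T, U). (T \<union> U, T)) ` Sigma (Pow S) (\<lambda>T. Pow (S - T))"
      by (intro image_eqI[of _ _ "(snd p, fst p - snd p)"]) auto
  qed auto
  also have "(\<Oplus>p\<in>\<dots>. f (fst p) (snd p))
      = (\<Oplus>p\<in>Sigma (Pow S) (\<lambda>T. Pow (S - T)). f (fst p \<union> snd p) (fst p))"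
    by (subst finsum_reindex)
       (auto simp: inj_on_def case_prod_beta intro!: f_closed)
  also have "\<dots> = (\<Oplus>p\<in>Sigma (Pow S) (\<lambda>T. Pow (S - T)). g (fst p) (snd p))"
    using fg g_closed by (intro finsum_cong' refl) auto
  also have "\<dots> = (\<Oplus>T\<in>Pow S. \<Oplus>U\<in>Pow (S - T). g T U)"
    using S g_closed by (intro finsum_Sigma[symmetric]) (auto dest: subset_trans)
  also have "\<dots> = (a \<otimes>\<^bsub>ext\<^esub> (b \<otimes>\<^bsub>ext\<^esub> c)) S"
    unfolding ext_mult[OF S]
  proof (intro finsum_cong' refl)
    fix T assume "T \<in> Pow S"
    then have T: "T \<subseteq> E" "S - T \<subseteq> E" "T \<subseteq> S" using S by auto
    have T': "\<And>U. U \<subseteq> S - T \<Longrightarrow> U \<subseteq> E \<and> S - T - U \<subseteq> E" using T by auto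
    have "shuffle_sign T (S - T) \<otimes> (a T \<otimes> (b \<otimes>\<^bsub>ext\<^esub> c) (S - T))
       = (shuffle_sign T (S - T) \<otimes> a T) \<otimes> (\<Oplus>U\<in>Pow (S - T). shuffle_sign U (S - T - U) \<otimes> (b U \<otimes> c (S - T - U)))"
      using T T' assms by (simp add: ext_mult m_ac finsum_closed Pi_def)
    also have "\<dots> = (\<Oplus>U\<in>Pow (S - T). (shuffle_sign T (S - T) \<otimes> a T) \<otimes> (shuffle_sign U (S - T - U) \<otimes> (b U \<otimes> c (S - T - U))))"
      using T T' assms by (intro finsum_rdistr) auto
    also have "\<dots> = (\<Oplus>U\<in>Pow (S - T). g T U)"
      using T T' assms g_closed by (intro finsum_cong' refl) (auto simp: g_def m_ac)
    finally show "(\<Oplus>U\<in>Pow (S - T). g T U) = shuffle_sign T (S - T) \<otimes> (a T \<otimes> (b \<otimes>\<^bsub>ext\<^esub> c) (S - T))" by simp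
  next
    show "(\<lambda>T. shuffle_sign T (S - T) \<otimes> (a T \<otimes> (b \<otimes>\<^bsub>ext\<^esub> c) (S - T))) \<in> Pow S \<rightarrow> carrier R"
      using S assms by (auto simp: ext_mult_closed subset_trans)
  qed
  finally show "((a \<otimes>\<^bsub>ext\<^esub> b) \<otimes>\<^bsub>ext\<^esub> c) S = (a \<otimes>\<^bsub>ext\<^esub> (b \<otimes>\<^bsub>ext\<^esub> c)) S" .
qed (use assms in \<open>auto intro!: ext_mult_closed\<close>)

lemma ext_ring: "ring ext"
proof (rule ringI, rule abelian_groupI)
  show "monoid ext"
    by (rule monoidI)
       (auto simp: ext_one ext_mult_closed ext_assoc ext_incl_mult intro!: ext_eqI)
next
  fix x assume x: "x \<in> carrier ext"
  show "\<exists>y\<in>carrier ext. y \<oplus>\<^bsub>ext\<^esub> x = \<zero>\<^bsub>ext\<^esub>"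
  proof
    show "(\<lambda>S\<in>Pow E. \<ominus> x S) \<oplus>\<^bsub>ext\<^esub> x = \<zero>\<^bsub>ext\<^esub>"
      using x by (intro ext_eqI)
        (auto simp: ext_zero ext_add l_neg ext_zero_closed intro!: ext_add_closed ext_carrierI)
  qed (use x in \<open>auto intro: ext_carrierI\<close>)
next
  fix x y z assume xyz: "x \<in> carrier ext" "y \<in> carrier ext" "z \<in> carrier ext"
  show "(x \<oplus>\<^bsub>ext\<^esub> y) \<otimes>\<^bsub>ext\<^esub> z = (x \<otimes>\<^bsub>ext\<^esub> z) \<oplus>\<^bsub>ext\<^esub> (y \<otimes>\<^bsub>ext\<^esub> z)"
  proof (rule ext_eqI)
    fix S assume S: "S \<subseteq> E"
    note sub = subset_trans[OF _ S]
    have "((x \<oplus>\<^bsub>ext\<^esub> y) \<otimes>\<^bsub>ext\<^esub> z) S = (\<Oplus>T\<in>Pow S.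
        shuffle_sign T (S - T) \<otimes> (x T \<otimes> z (S - T)) \<oplus> shuffle_sign T (S - T) \<otimes> (y T \<otimes> z (S - T)))"
      unfolding ext_mult[OF S] using xyz S
      by (intro finsum_cong' refl) (auto simp: ext_add sub l_distr r_distr)
    also have "\<dots> = ((x \<otimes>\<^bsub>ext\<^esub> z) \<oplus>\<^bsub>ext\<^esub> (y \<otimes>\<^bsub>ext\<^esub> z)) S"
      using xyz S by (subst finsum_addf) (auto simp: ext_add ext_mult sub)
    finally show "((x \<oplus>\<^bsub>ext\<^esub> y) \<otimes>\<^bsub>ext\<^esub> z) S = ((x \<otimes>\<^bsub>ext\<^esub> z) \<oplus>\<^bsub>ext\<^esub> (y \<otimes>\<^bsub>ext\<^esub> z)) S" .
  qed (use xyz in \<open>auto intro!: ext_mult_closed ext_add_closed\<close>)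
  show "z \<otimes>\<^bsub>ext\<^esub> (x \<oplus>\<^bsub>ext\<^esub> y) = (z \<otimes>\<^bsub>ext\<^esub> x) \<oplus>\<^bsub>ext\<^esub> (z \<otimes>\<^bsub>ext\<^esub> y)"
  proof (rule ext_eqI)
    fix S assume S: "S \<subseteq> E"
    note sub = subset_trans[OF _ S]
    have "(z \<otimes>\<^bsub>ext\<^esub> (x \<oplus>\<^bsub>ext\<^esub> y)) S = (\<Oplus>T\<in>Pow S.
        shuffle_sign T (S - T) \<otimes> (z T \<otimes> x (S - T)) \<oplus> shuffle_sign T (S - T) \<otimes> (z T \<otimes> y (S - T)))"
      unfolding ext_mult[OF S] using xyz S
      by (intro finsum_cong' refl) (auto simp: ext_add sub r_distr Diff_subset_conv le_supI2)
    also have "\<dots> = ((z \<otimes>\<^bsub>ext\<^esub> x) \<oplus>\<^bsub>ext\<^esub> (z \<otimes>\<^bsub>ext\<^esub> y)) S"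
      using xyz S by (subst finsum_addf) (auto simp: ext_add ext_mult sub)
    finally show "(z \<otimes>\<^bsub>ext\<^esub> (x \<oplus>\<^bsub>ext\<^esub> y)) S = ((z \<otimes>\<^bsub>ext\<^esub> x) \<oplus>\<^bsub>ext\<^esub> (z \<otimes>\<^bsub>ext\<^esub> y)) S" .
  qed (use xyz in \<open>auto intro!: ext_mult_closed ext_add_closed\<close>)
qed (auto intro!: ext_eqI ext_add_closed ext_zero_closed simp: ext_add ext_zero a_ac)

end

sublocale exterior_algebra \<subseteq> X: ring "ext_alg R E r"
  by (rule ext_ring)

section \<open>The differential of an exterior algebra\<close>

context exterior_algebra
begin

lemma ext_neg:
  assumes "a \<in> carrier ext" "S \<subseteq> E"
  shows "(\<ominus>\<^bsub>ext\<^esub> a) S = \<ominus> a S"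
proof -
  have "(\<ominus>\<^bsub>ext\<^esub> a) S \<oplus> a S = \<zero>"
    using X.l_neg[OF assms(1)] assms by (metis ext_add ext_zero)
  then show ?thesis using assms by (intro minus_equality[symmetric]) auto
qed

lemma ext_incl_hom: "ext_incl R E \<in> ring_hom R ext"
proof (rule ring_hom_memI)
  fix p q assume pq: "p \<in> carrier R" "q \<in> carrier R"
  show "ext_incl R E (p \<otimes> q) = ext_incl R E p \<otimes>\<^bsub>ext\<^esub> ext_incl R E q"
    using pq by (intro ext_eqI) (auto simp: ext_incl_mult ext_incl_coeff m_comm)
  show "ext_incl R E (p \<oplus> q) = ext_incl R E p \<oplus>\<^bsub>ext\<^esub> ext_incl R E q"
    using pq by (intro ext_eqI) (auto simp: ext_incl_coeff ext_add)
qed (auto simp: ext_one)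

lemma ext_incl_central:
  "\<lbrakk>p \<in> carrier R; a \<in> carrier ext\<rbrakk> \<Longrightarrow> ext_incl R E p \<otimes>\<^bsub>ext\<^esub> a = a \<otimes>\<^bsub>ext\<^esub> ext_incl R E p"
  by (rule ext_eqI) (auto simp: ext_incl_mult)

definition parity :: "('e set \<Rightarrow> 'a) \<Rightarrow> 'e set \<Rightarrow> 'a" where
  "parity a = (\<lambda>S\<in>Pow E. parity_sign S \<otimes> a S)"

lemma parity_coeff: "S \<subseteq> E \<Longrightarrow> parity a S = parity_sign S \<otimes> a S"
  by (simp add: parity_def)

lemma parity_closed [simp]: "a \<in> carrier ext \<Longrightarrow> parity a \<in> carrier ext"
  unfolding parity_def by (intro ext_carrierI) auto

lemma parity_hom: "parity \<in> ring_hom ext ext"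
proof (rule ring_hom_memI)
  fix a b assume ab: "a \<in> carrier ext" "b \<in> carrier ext"
  show "parity (a \<otimes>\<^bsub>ext\<^esub> b) = parity a \<otimes>\<^bsub>ext\<^esub> parity b"
  proof (rule ext_eqI)
    fix S assume S: "S \<subseteq> E"
    note sub = subset_trans[OF _ S]
    have "parity (a \<otimes>\<^bsub>ext\<^esub> b) S = (\<Oplus>T\<in>Pow S. parity_sign S \<otimes> (shuffle_sign T (S - T) \<otimes> (a T \<otimes> b (S - T))))"
      unfolding parity_coeff[OF S] ext_mult[OF S] using ab S
      by (intro finsum_rdistr) (auto simp: sub)
    also have "\<dots> = (parity a \<otimes>\<^bsub>ext\<^esub> parity b) S"
      unfolding ext_mult[OF S]
    proof (intro finsum_cong' refl)
      fix T assume "T \<in> Pow S"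
      then have T: "T \<subseteq> E" "S - T \<subseteq> E" "T \<union> (S - T) = S" using S by auto
      then have "parity_sign S = parity_sign T \<otimes> parity_sign (S - T)" using parity_sign_Un[of T "S - T"] by auto
      then show "parity_sign S \<otimes> (shuffle_sign T (S - T) \<otimes> (a T \<otimes> b (S - T)))
          = shuffle_sign T (S - T) \<otimes> (parity a T \<otimes> parity b (S - T))"
        using T ab by (simp add: parity_coeff m_ac)
    qed (use ab S sub in auto)
    finally show "parity (a \<otimes>\<^bsub>ext\<^esub> b) S = (parity a \<otimes>\<^bsub>ext\<^esub> parity b) S" .
  qed (use ab in auto)
  show "parity (a \<oplus>\<^bsub>ext\<^esub> b) = parity a \<oplus>\<^bsub>ext\<^esub> parity b"
    using ab by (intro ext_eqI) (auto simp: parity_coeff ext_add r_distr)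
qed (auto simp: ext_one ext_incl_coeff parity_coeff intro!: ext_eqI)

lemma parity_parity: "a \<in> carrier ext \<Longrightarrow> parity (parity a) = a"
  by (rule ext_eqI) (auto simp: parity_coeff)

lemma parity_incl: "p \<in> carrier R \<Longrightarrow> parity (ext_incl R E p) = ext_incl R E p"
  by (rule ext_eqI) (auto simp: parity_coeff ext_incl_coeff)

lemma ext_gen_closed [simp]: "ext_gen R E e \<in> carrier ext"
  unfolding ext_gen_def by (intro ext_carrierI) auto

lemma ext_gen_coeff: "S \<subseteq> E \<Longrightarrow> ext_gen R E e S = (if S = {e} then \<one> else \<zero>)"
  by (simp add: ext_gen_def)

lemma parity_gen: "e \<in> E \<Longrightarrow> parity (ext_gen R E e) = \<ominus>\<^bsub>ext\<^esub> ext_gen R E e"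
  using parity_sign_insert[of "{}" e]
  by (intro ext_eqI) (auto simp: parity_coeff ext_neg ext_gen_coeff)

lemma shuffle_sign_square: "shuffle_sign S T \<otimes> shuffle_sign S T = \<one>"
  by (simp add: shuffle_sign_def)

text \<open>The antiderivation with \<open>g\<^sub>e \<mapsto> 1\<close> that kills the other generators. The differential is the
combination of the contractions with coefficients \<open>\<delta> e\<close>, so the Leibniz rule can be verified for
one generator at a time.\<close>

definition contraction :: "'e \<Rightarrow> ('e set \<Rightarrow> 'a) \<Rightarrow> 'e set \<Rightarrow> 'a" where
  "contraction e a S = (if e \<in> S then \<zero> else shuffle_sign {e} S \<otimes> a (insert e S))"

lemma contraction_closed [simp]:
  "\<lbrakk>e \<in> E; a \<in> carrier ext; S \<subseteq> E\<rbrakk> \<Longrightarrow> contraction e a S \<in> carrier R"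
  "\<lbrakk>e \<in> E; a \<in> carrier ext; S \<subseteq> E\<rbrakk> \<Longrightarrow> contraction e a (S - T) \<in> carrier R"
proof -
  have *: "contraction e a S \<in> carrier R" if "e \<in> E" "a \<in> carrier ext" "S \<subseteq> E" for S
    using that by (simp add: contraction_def)
  show "\<lbrakk>e \<in> E; a \<in> carrier ext; S \<subseteq> E\<rbrakk> \<Longrightarrow> contraction e a S \<in> carrier R"
    by (rule *)
  show "\<lbrakk>e \<in> E; a \<in> carrier ext; S \<subseteq> E\<rbrakk> \<Longrightarrow> contraction e a (S - T) \<in> carrier R"
    by (rule *) auto
qed

text \<open>If \<open>e \<notin> S\<close>, the subsets of \<open>insert e S\<close> that contain \<open>e\<close> give the first summand and the others
give the second. If \<open>e \<in> S\<close>, the left side is zero, and on the right the term where \<open>e\<close> is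
contracted out of \<open>a\<close> cancels the term where it is contracted out of \<open>b\<close>.\<close>

lemma contraction_mult:
  assumes e: "e \<in> E" and ab: "a \<in> carrier ext" "b \<in> carrier ext" and S: "S \<subseteq> E"
  shows "contraction e (a \<otimes>\<^bsub>ext\<^esub> b) S
    = (\<Oplus>T\<in>Pow S. shuffle_sign T (S - T) \<otimes> (contraction e a T \<otimes> b (S - T))
         \<oplus> shuffle_sign T (S - T) \<otimes> (parity_sign T \<otimes> a T \<otimes> contraction e b (S - T)))"
    (is "_ = (\<Oplus>T\<in>Pow S. ?f T)")
proof (cases "e \<in> S")
  case False
  have eS: "insert e S \<subseteq> E" using e S by auto
  let ?g = "\<lambda>T. shuffle_sign T (insert e S - T) \<otimes> (a T \<otimes> b (insert e S - T))"
  have g: "?g T \<in> carrier R" if "T \<subseteq> insert e S" for T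
    using that ab eS subset_trans[OF _ eS] by simp
  have "contraction e (a \<otimes>\<^bsub>ext\<^esub> b) S = shuffle_sign {e} S \<otimes> (\<Oplus>T\<in>Pow S. ?g T \<oplus> ?g (insert e T))"
    using False g S by (simp add: contraction_def ext_mult[OF eS] finsum_Pow_insert)
  also have "\<dots> = (\<Oplus>T\<in>Pow S. shuffle_sign {e} S \<otimes> (?g T \<oplus> ?g (insert e T)))"
    using S by (intro finsum_rdistr Pi_I a_closed g) auto
  also have "\<dots> = (\<Oplus>T\<in>Pow S. ?f T)"
  proof (intro finsum_cong' refl)
    fix T assume "T \<in> Pow S"
    define W where "W = S - T"
    then have T: "T \<subseteq> E" "W \<subseteq> E" "e \<notin> T" "e \<notin> W" "T \<inter> W = {}" "S = T \<union> W" "insert e T \<subseteq> E" "insert e W \<subseteq> E"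
      using \<open>T \<in> Pow S\<close> S e False by auto
    have sets: "insert e S - T = insert e W" "insert e S - insert e T = W"
      using T by auto
    have signs: "shuffle_sign {e} S = shuffle_sign {e} T \<otimes> shuffle_sign {e} W" "shuffle_sign T (insert e W) = shuffle_sign T {e} \<otimes> shuffle_sign T W"
      "shuffle_sign (insert e T) W = shuffle_sign {e} W \<otimes> shuffle_sign T W" "parity_sign T = shuffle_sign {e} T \<otimes> shuffle_sign T {e}"
      using e T by (auto simp: shuffle_sign_Un_right shuffle_sign_insert_right[of e W T] shuffle_sign_insert_left[of e T W] shuffle_sign_swap)
    have cl: "a T \<in> carrier R" "a (insert e T) \<in> carrier R" "b W \<in> carrier R" "b (insert e W) \<in> carrier R"
      using T ab by auto
    show "shuffle_sign {e} S \<otimes> (?g T \<oplus> ?g (insert e T)) = ?f T"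
      unfolding sets W_def[symmetric] using T(3,4) cl
      by (simp add: contraction_def signs r_distr m_ac a_ac shuffle_sign_square)
  qed (use e ab S subset_trans[OF _ S] in auto)
  finally show ?thesis .
next
  case True
  define U where "U = S - {e}"
  have U: "S = insert e U" "e \<notin> U" "U \<subseteq> E" using True S by (auto simp: U_def)
  have f: "?f T \<in> carrier R" if "T \<subseteq> S" for T
    using that ab e S subset_trans[OF _ S] by simp
  have "(\<Oplus>T\<in>Pow S. ?f T) = (\<Oplus>T\<in>Pow U. ?f T \<oplus> ?f (insert e T))"
    using f U by (simp add: finsum_Pow_insert)
  also have "\<dots> = \<zero>"
  proof (intro add.finprod_one_eqI)
    fix T assume "T \<in> Pow U"
    define W where "W = U - T"
    then have T: "T \<subseteq> E" "W \<subseteq> E" "e \<notin> T" "e \<notin> W" "T \<inter> W = {}" "U = T \<union> W" "insert e T \<subseteq> E" "insert e W \<subseteq> E"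
      using \<open>T \<in> Pow U\<close> S e U by auto
    have sets: "S - T = insert e W" "S - insert e T = W"
      using T U by auto
    have signs: "shuffle_sign T (insert e W) = shuffle_sign T {e} \<otimes> shuffle_sign T W"
      "shuffle_sign (insert e T) W = shuffle_sign {e} W \<otimes> shuffle_sign T W" "parity_sign (insert e T) = \<ominus> (shuffle_sign {e} T \<otimes> shuffle_sign T {e})"
      using e T by (auto simp: parity_sign_insert shuffle_sign_insert_right[of e W T] shuffle_sign_insert_left[of e T W] shuffle_sign_swap)
    have cl: "a T \<in> carrier R" "a (insert e T) \<in> carrier R" "b W \<in> carrier R" "b (insert e W) \<in> carrier R"
      using T ab by auto
    show "?f T \<oplus> ?f (insert e T) = \<zero>"
      unfolding sets using T(3,4) cl
      by (simp add: contraction_def signs l_minus r_minus m_ac r_neg shuffle_sign_square)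
  qed
  finally show ?thesis using True by (simp add: contraction_def)
qed

end

locale exterior_derivation = exterior_algebra R E r
    for R :: "('a, 'm) ring_scheme" (structure) and E :: "'e set" and r +
  fixes \<delta> :: "'e \<Rightarrow> 'a"
  assumes \<delta>_closed: "e \<in> E \<Longrightarrow> \<delta> e \<in> carrier R"
begin

abbreviation diff where "diff \<equiv> ext_diff R E r \<delta>"

lemma diff_coeff:
  assumes "a \<in> carrier ext" "S \<subseteq> E"
  shows "diff a S = (\<Oplus>e\<in>E. \<delta> e \<otimes> contraction e a S)"
proof -
  have "diff a S = (\<Oplus>e\<in>E - S. \<delta> e \<otimes> contraction e a S)"
    unfolding ext_diff_def using assms \<delta>_closed
    by (auto simp: contraction_def shuffle_sign_def[symmetric] m_lcomm intro!: finsum_cong')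
  also have "\<dots> = (\<Oplus>e\<in>E. \<delta> e \<otimes> contraction e a S)"
    using assms \<delta>_closed finite_E
    by (intro add.finprod_mono_neutral_cong_left) (auto simp: contraction_def)
  finally show ?thesis .
qed

lemma diff_closed: "a \<in> carrier ext \<Longrightarrow> diff a \<in> carrier ext"
proof -
  assume a: "a \<in> carrier ext"
  have "(\<lambda>S\<in>Pow E. diff a S) \<in> carrier ext"
    using a \<delta>_closed by (intro ext_carrierI) (auto simp: diff_coeff intro!: finsum_closed)
  moreover have "(\<lambda>S\<in>Pow E. diff a S) = diff a" by (auto simp: ext_diff_def)
  ultimately show ?thesis by simp
qed

lemma diff_leibniz:
  assumes ab: "a \<in> carrier ext" "b \<in> carrier ext"
  shows "diff (a \<otimes>\<^bsub>ext\<^esub> b) = diff a \<otimes>\<^bsub>ext\<^esub> b \<oplus>\<^bsub>ext\<^esub> parity a \<otimes>\<^bsub>ext\<^esub> diff b"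
proof (rule ext_eqI)
  fix S assume S: "S \<subseteq> E"
  note sub = subset_trans[OF _ S]
  let ?f = "\<lambda>e T. shuffle_sign T (S - T) \<otimes> (contraction e a T \<otimes> b (S - T))"
  let ?g = "\<lambda>e T. shuffle_sign T (S - T) \<otimes> (parity_sign T \<otimes> a T \<otimes> contraction e b (S - T))"
  have "diff (a \<otimes>\<^bsub>ext\<^esub> b) S = (\<Oplus>e\<in>E. \<Oplus>T\<in>Pow S. \<delta> e \<otimes> (?f e T \<oplus> ?g e T))"
    unfolding diff_coeff[OF X.m_closed[OF ab] S]
  proof (intro finsum_cong' refl)
    fix e assume e: "e \<in> E"
    show "\<delta> e \<otimes> contraction e (a \<otimes>\<^bsub>ext\<^esub> b) S = (\<Oplus>T\<in>Pow S. \<delta> e \<otimes> (?f e T \<oplus> ?g e T))"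
      unfolding contraction_mult[OF e ab S] using e ab S \<delta>_closed
      by (intro finsum_rdistr) (auto simp: sub)
  qed (use ab S \<delta>_closed sub in \<open>auto intro!: finsum_closed\<close>)
  also have "\<dots> = (\<Oplus>T\<in>Pow S. \<Oplus>e\<in>E. \<delta> e \<otimes> (?f e T \<oplus> ?g e T))"
    using ab S \<delta>_closed finite_E by (intro finsum_swap) (auto simp: sub)
  also have "\<dots> = (\<Oplus>T\<in>Pow S. shuffle_sign T (S - T) \<otimes> (diff a T \<otimes> b (S - T))
      \<oplus> shuffle_sign T (S - T) \<otimes> (parity a T \<otimes> diff b (S - T)))"
  proof (intro finsum_cong' refl)
    fix T assume "T \<in> Pow S"
    then have T: "T \<subseteq> E" "S - T \<subseteq> E" using S by auto
    have "(\<Oplus>e\<in>E. \<delta> e \<otimes> (?f e T \<oplus> ?g e T))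
      = (\<Oplus>e\<in>E. (shuffle_sign T (S - T) \<otimes> b (S - T)) \<otimes> (\<delta> e \<otimes> contraction e a T)
           \<oplus> (shuffle_sign T (S - T) \<otimes> parity a T) \<otimes> (\<delta> e \<otimes> contraction e b (S - T)))"
      using T ab \<delta>_closed by (intro finsum_cong' refl) (auto simp: parity_coeff r_distr m_ac)
    also have "\<dots> = (\<Oplus>e\<in>E. (shuffle_sign T (S - T) \<otimes> b (S - T)) \<otimes> (\<delta> e \<otimes> contraction e a T))
           \<oplus> (\<Oplus>e\<in>E. (shuffle_sign T (S - T) \<otimes> parity a T) \<otimes> (\<delta> e \<otimes> contraction e b (S - T)))"
      using T ab \<delta>_closed by (intro finsum_addf) auto
    also have "(\<Oplus>e\<in>E. (shuffle_sign T (S - T) \<otimes> b (S - T)) \<otimes> (\<delta> e \<otimes> contraction e a T))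
        = (shuffle_sign T (S - T) \<otimes> b (S - T)) \<otimes> diff a T"
      unfolding diff_coeff[OF ab(1) T(1)]
      using T ab \<delta>_closed finite_E by (intro finsum_rdistr[symmetric]) auto
    also have "(\<Oplus>e\<in>E. (shuffle_sign T (S - T) \<otimes> parity a T) \<otimes> (\<delta> e \<otimes> contraction e b (S - T)))
        = (shuffle_sign T (S - T) \<otimes> parity a T) \<otimes> diff b (S - T)"
      unfolding diff_coeff[OF ab(2) T(2)]
      using T ab \<delta>_closed finite_E by (intro finsum_rdistr[symmetric]) auto
    finally show "(\<Oplus>e\<in>E. \<delta> e \<otimes> (?f e T \<oplus> ?g e T)) = shuffle_sign T (S - T) \<otimes> (diff a T \<otimes> b (S - T))
      \<oplus> shuffle_sign T (S - T) \<otimes> (parity a T \<otimes> diff b (S - T))"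
      using T ab diff_closed by (simp add: m_ac)
  qed (use ab S sub diff_closed in auto)
  also have "\<dots> = (diff a \<otimes>\<^bsub>ext\<^esub> b \<oplus>\<^bsub>ext\<^esub> parity a \<otimes>\<^bsub>ext\<^esub> diff b) S"
    unfolding ext_add[OF S] ext_mult[OF S]
    using ab S sub diff_closed by (intro finsum_addf) auto
  finally show "diff (a \<otimes>\<^bsub>ext\<^esub> b) S = (diff a \<otimes>\<^bsub>ext\<^esub> b \<oplus>\<^bsub>ext\<^esub> parity a \<otimes>\<^bsub>ext\<^esub> diff b) S" .
qed (use ab in \<open>auto intro!: diff_closed X.a_closed X.m_closed\<close>)

lemma diff_add:
  assumes ab: "a \<in> carrier ext" "b \<in> carrier ext"
  shows "diff (a \<oplus>\<^bsub>ext\<^esub> b) = diff a \<oplus>\<^bsub>ext\<^esub> diff b"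
proof (rule ext_eqI)
  fix S assume S: "S \<subseteq> E"
  have "diff (a \<oplus>\<^bsub>ext\<^esub> b) S = (\<Oplus>e\<in>E. \<delta> e \<otimes> contraction e a S \<oplus> \<delta> e \<otimes> contraction e b S)"
    unfolding diff_coeff[OF X.a_closed[OF ab] S] using ab S \<delta>_closed
    by (intro finsum_cong' refl) (auto simp: contraction_def ext_add r_distr)
  also have "\<dots> = (diff a \<oplus>\<^bsub>ext\<^esub> diff b) S"
    unfolding ext_add[OF S] diff_coeff[OF ab(1) S] diff_coeff[OF ab(2) S]
    using ab S \<delta>_closed by (intro finsum_addf) auto
  finally show "diff (a \<oplus>\<^bsub>ext\<^esub> b) S = (diff a \<oplus>\<^bsub>ext\<^esub> diff b) S" .
qed (use ab in \<open>auto intro!: diff_closed X.a_closed X.m_closed\<close>)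

lemma diff_parity:
  assumes a: "a \<in> carrier ext"
  shows "diff (parity a) = \<ominus>\<^bsub>ext\<^esub> parity (diff a)"
proof (rule ext_eqI)
  fix S assume S: "S \<subseteq> E"
  have "diff (parity a) S = (\<Oplus>e\<in>E. (\<ominus> parity_sign S) \<otimes> (\<delta> e \<otimes> contraction e a S))"
    unfolding diff_coeff[OF parity_closed[OF a] S] using a S \<delta>_closed
    by (intro finsum_cong' refl)
       (auto simp: contraction_def parity_coeff parity_sign_insert l_minus r_minus m_ac)
  also have "\<dots> = (\<ominus> parity_sign S) \<otimes> diff a S"
    unfolding diff_coeff[OF a S] using a S \<delta>_closed finite_E
    by (intro finsum_rdistr[symmetric]) auto
  also have "\<dots> = (\<ominus>\<^bsub>ext\<^esub> parity (diff a)) S"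
    using a S by (simp add: ext_neg parity_coeff diff_closed l_minus)
  finally show "diff (parity a) S = (\<ominus>\<^bsub>ext\<^esub> parity (diff a)) S" .
qed (use a in \<open>auto intro!: diff_closed parity_closed X.a_inv_closed\<close>)

text \<open>The double contraction with \<open>e\<close> and \<open>f\<close> is antisymmetric in \<open>e\<close> and \<open>f\<close>, while \<open>\<delta> e \<delta> f\<close> is
symmetric.\<close>

lemma diff_diff:
  assumes a: "a \<in> carrier ext"
  shows "diff (diff a) = \<zero>\<^bsub>ext\<^esub>"
proof (rule ext_eqI)
  fix S assume S: "S \<subseteq> E"
  define g where "g e f = (if e \<in> S then \<zero> else
     (\<delta> e \<otimes> shuffle_sign {e} S) \<otimes> (\<delta> f \<otimes> contraction f a (insert e S)))" for e f
  have g_closed: "g e f \<in> carrier R" if "e \<in> E" "f \<in> E" for e f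
    using that a S \<delta>_closed by (auto simp: g_def)
  have "diff (diff a) S = (\<Oplus>e\<in>E. \<Oplus>f\<in>E. g e f)"
    unfolding diff_coeff[OF diff_closed[OF a] S]
  proof (intro finsum_cong' refl)
    fix e assume e: "e \<in> E"
    show "\<delta> e \<otimes> contraction e (diff a) S = (\<Oplus>f\<in>E. g e f)"
    proof (cases "e \<in> S")
      case True
      then show ?thesis using e \<delta>_closed by (simp add: g_def contraction_def)
    next
      case False
      have eS: "insert e S \<subseteq> E" using e S by auto
      have "\<delta> e \<otimes> contraction e (diff a) S = (\<delta> e \<otimes> shuffle_sign {e} S) \<otimes> diff a (insert e S)"
        using False e \<delta>_closed eS a by (simp add: contraction_def m_assoc diff_closed)
      also have "\<dots> = (\<Oplus>f\<in>E. g e f)"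
        unfolding diff_coeff[OF a eS] using e a eS \<delta>_closed finite_E False
        by (subst finsum_rdistr) (auto simp: g_def intro!: finsum_cong')
      finally show ?thesis .
    qed
  qed (use g_closed in \<open>auto intro!: finsum_closed\<close>)
  also have "\<dots> = \<zero>"
  proof (rule finsum_antisym[OF finite_E g_closed])
    show "g e e = \<zero>" if "e \<in> E" for e
      using that \<delta>_closed by (simp add: g_def contraction_def)
    fix e f assume ef: "e \<in> E" "f \<in> E"
    show "g f e = \<ominus> g e f"
    proof (cases "e = f \<or> e \<in> S \<or> f \<in> S")
      case True
      then show ?thesis using ef \<delta>_closed by (auto simp: g_def contraction_def)
    next
      case False
      have "a (insert e (insert f S)) \<in> carrier R" using a S ef by auto
      moreover have "f \<noteq> e" using False by auto
      moreover have "insert f (insert e S) = insert e (insert f S)" by auto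
      moreover have "shuffle_sign {f} {e} = \<ominus> shuffle_sign {e} {f}" using shuffle_sign_singletons ef False by auto
      ultimately show ?thesis
        using False ef \<delta>_closed S
        by (simp add: g_def contraction_def shuffle_sign_insert_right[of e S "{f}"] shuffle_sign_insert_right[of f S "{e}"]
              l_minus r_minus m_ac)
    qed
  qed
  finally show "diff (diff a) S = \<zero>\<^bsub>ext\<^esub> S" using S by (simp add: ext_zero)
qed (use a in \<open>auto intro!: diff_closed parity_closed X.a_inv_closed\<close>)

lemma diff_gen:
  assumes e: "e \<in> E"
  shows "diff (ext_gen R E e) = ext_incl R E (\<delta> e)"
proof (rule ext_eqI)
  fix S assume S: "S \<subseteq> E"
  have "diff (ext_gen R E e) S = (\<Oplus>f\<in>E. if e = f then (if S = {} then \<delta> f else \<zero>) else \<zero>)"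
    unfolding diff_coeff[OF ext_gen_closed S] using S \<delta>_closed
    by (intro finsum_cong' refl) (auto simp: contraction_def ext_gen_def)
  also have "\<dots> = (if S = {} then \<delta> e else \<zero>)"
    using e \<delta>_closed finite_E by (subst finsum_singleton) auto
  finally show "diff (ext_gen R E e) S = ext_incl R E (\<delta> e) S"
    using S by (simp add: ext_incl_coeff)
qed (use e \<delta>_closed in \<open>auto intro: diff_closed\<close>)

lemma diff_incl:
  assumes p: "p \<in> carrier R"
  shows "diff (ext_incl R E p) = \<zero>\<^bsub>ext\<^esub>"
proof (rule ext_eqI)
  fix S assume S: "S \<subseteq> E"
  have "diff (ext_incl R E p) S = (\<Oplus>e\<in>E. \<zero>)"
    unfolding diff_coeff[OF ext_incl_closed[OF p] S] using S p \<delta>_closed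
    by (intro finsum_cong' refl) (auto simp: contraction_def ext_incl_def)
  then show "diff (ext_incl R E p) S = \<zero>\<^bsub>ext\<^esub> S" using S by (simp add: ext_zero)
qed (use p in \<open>auto intro: diff_closed\<close>)

lemma dg_ring: "dg_ring ext parity diff"
  by unfold_locales
     (simp_all add: parity_hom parity_parity diff_closed diff_add diff_leibniz diff_parity diff_diff)

end

section \<open>Boundaries of words\<close>

context ring
begin

lemma word_prod_Nil [simp]: "word_prod R [] = \<one>"
  by (simp add: word_prod_def)

lemma word_prod_Cons [simp]: "word_prod R (x # xs) = x \<otimes> word_prod R xs"
  by (simp add: word_prod_def)

lemma word_prod_closed [simp]: "set xs \<subseteq> carrier R \<Longrightarrow> word_prod R xs \<in> carrier R"
  by (induction xs) auto

lemma word_prod_append: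
  "\<lbrakk>set xs \<subseteq> carrier R; set ys \<subseteq> carrier R\<rbrakk>
    \<Longrightarrow> word_prod R (xs @ ys) = word_prod R xs \<otimes> word_prod R ys"
  by (induction xs) (auto simp: m_assoc)

lemma word_boundary_Nil [simp]: "word_boundary R [] = \<zero>"
  by (simp add: word_boundary_def)

lemma word_boundary_closed [simp]: "set xs \<subseteq> carrier R \<Longrightarrow> word_boundary R xs \<in> carrier R"
  unfolding word_boundary_def
  by (intro finsum_closed Pi_I m_closed word_prod_closed sign_pow_closed)
     (auto dest: in_set_takeD in_set_dropD)

text \<open>This is the Leibniz rule for the derivation that sends every letter to one. It replaces the
indexed sum by a recursion, so that the statements about words below are proved by list
induction.\<close>

lemma word_boundary_Cons:
  assumes "x \<in> carrier R" "set xs \<subseteq> carrier R"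
  shows "word_boundary R (x # xs) = word_prod R xs \<ominus> x \<otimes> word_boundary R xs"
proof -
  define w where "w i = word_prod R (take i xs @ drop (Suc i) xs)" for i
  have w: "w i \<in> carrier R" for i
    unfolding w_def using assms by (intro word_prod_closed) (auto dest: in_set_takeD in_set_dropD)
  define f where "f i = sign_pow R i \<otimes> word_prod R (take i (x # xs) @ drop (Suc i) (x # xs))" for i
  have f_0: "f 0 = word_prod R xs" using assms by (simp add: f_def)
  have f_Suc: "f (Suc i) = (\<ominus> x) \<otimes> (sign_pow R i \<otimes> w i)" for i
    using assms w[of i]
    by (simp add: f_def w_def[symmetric] sign_pow_Suc l_minus sign_pow_commute[of x] m_assoc[symmetric])
  have "word_boundary R (x # xs) = (\<Oplus>i\<in>insert 0 (Suc ` {..<length xs}). f i)"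
    by (simp only: word_boundary_def length_Cons lessThan_Suc_eq_insert_0 f_def)
  also have "\<dots> = f 0 \<oplus> (\<Oplus>i\<in>Suc ` {..<length xs}. f i)"
    using assms w by (intro finsum_insert) (auto simp: f_0 f_Suc)
  also have "(\<Oplus>i\<in>Suc ` {..<length xs}. f i) = (\<Oplus>i\<in>{..<length xs}. f (Suc i))"
    using assms w by (intro finsum_reindex) (auto simp: f_Suc)
  also have "\<dots> = (\<Oplus>i\<in>{..<length xs}. (\<ominus> x) \<otimes> (sign_pow R i \<otimes> w i))"
    by (simp only: f_Suc)
  also have "\<dots> = (\<ominus> x) \<otimes> word_boundary R xs"
    unfolding word_boundary_def w_def[symmetric]
    using assms w by (intro finsum_rdistr[symmetric]) auto
  finally show ?thesis using assms by (simp add: f_0 a_minus_def l_minus)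
qed

end

context dg_ring
begin

text \<open>A word of odd letters and its boundary have opposite parities. Only the resulting alternative is
recorded, as it suffices for the ideal to contain \<open>s x\<close> along with the boundary \<open>x\<close>.\<close>

lemma s_word:
  assumes "set xs \<subseteq> carrier A" "\<And>x. x \<in> set xs \<Longrightarrow> s x = \<ominus> x"
  shows "s (word_prod A xs) = word_prod A xs \<and> s (word_boundary A xs) = \<ominus> word_boundary A xs
    \<or> s (word_prod A xs) = \<ominus> word_prod A xs \<and> s (word_boundary A xs) = word_boundary A xs"
  using assms
proof (induction xs)
  case Nil
  show ?case by simp
next
  case (Cons x xs)
  have xs: "x \<in> carrier A" "set xs \<subseteq> carrier A" "s x = \<ominus> x" using Cons.prems by auto
  consider "s (word_prod A xs) = word_prod A xs" "s (word_boundary A xs) = \<ominus> word_boundary A xs"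
    | "s (word_prod A xs) = \<ominus> word_prod A xs" "s (word_boundary A xs) = word_boundary A xs"
    using Cons by auto
  then show ?case
    using xs by cases
      (simp_all add: s_mult word_boundary_Cons a_minus_def s_add s_neg l_minus r_minus minus_add)
qed

text \<open>If \<open>d\<close> took the same central value \<open>c\<close> on all letters, then \<open>d\<close> of a word would be \<open>c\<close> times its
boundary. With \<open>c = d y\<close>, the defect is a signed sum of \<open>(d b - d y) w\<close>, where \<open>w\<close> is the word
with one occurrence of the letter \<open>b\<close> deleted. The prefix \<open>z\<close> collects the letters already
passed in the induction.\<close>

lemma boundary_defect_in_subgroup:
  assumes "additive_subgroup I A" "y \<in> carrier A" "z \<in> carrier A"
    and "set xs \<subseteq> carrier A"
    and "\<And>x. x \<in> set xs \<Longrightarrow> s x = \<ominus> x"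
    and "\<And>x a. \<lbrakk>x \<in> insert y (set xs); a \<in> carrier A\<rbrakk> \<Longrightarrow> d x \<otimes> a = a \<otimes> d x"
    and "\<And>B b C. xs = B @ b # C \<Longrightarrow> z \<otimes> ((d b \<ominus> d y) \<otimes> word_prod A (B @ C)) \<in> I"
  shows "z \<otimes> (d (word_prod A xs) \<ominus> d y \<otimes> word_boundary A xs) \<in> I"
  using assms(3-)
proof (induction xs arbitrary: z)
  case Nil
  then show ?case
    using assms(1,2) by (simp add: a_minus_def additive_subgroup.zero_closed)
next
  case (Cons x xs)
  interpret I: additive_subgroup I A by (rule assms(1))
  have x: "x \<in> carrier A" "set xs \<subseteq> carrier A" "s x = \<ominus> x" using Cons.prems by auto
  have comm: "x \<otimes> (d a \<otimes> u) = d a \<otimes> (x \<otimes> u)"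
    if "a \<in> insert y (set xs)" "u \<in> carrier A" for a u
  proof -
    have "a \<in> carrier A" using that(1) assms(2) x by auto
    moreover have "d a \<otimes> x = x \<otimes> d a" using that(1) x by (intro Cons.prems(4)) auto
    ultimately show ?thesis using that(2) x by (simp add: m_assoc[symmetric])
  qed
  have hd: "z \<otimes> ((d x \<ominus> d y) \<otimes> word_prod A xs) \<in> I"
    using Cons.prems(5)[of "[]" x xs] by simp
  have tl: "(z \<otimes> x) \<otimes> (d (word_prod A xs) \<ominus> d y \<otimes> word_boundary A xs) \<in> I"
  proof (rule Cons.IH)
    fix B b C assume eq: "xs = B @ b # C"
    then have b: "b \<in> carrier A" "b \<in> set xs" "set (B @ C) \<subseteq> carrier A" using x by auto
    have "z \<otimes> ((d b \<ominus> d y) \<otimes> word_prod A ((x # B) @ C)) \<in> I"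
      using eq by (intro Cons.prems(5)) simp
    moreover have "x \<otimes> ((d b \<ominus> d y) \<otimes> word_prod A (B @ C)) = (d b \<ominus> d y) \<otimes> (x \<otimes> word_prod A (B @ C))"
      using b x assms(2) comm
      by (simp add: a_minus_def l_distr r_distr l_minus r_minus del: set_append)
    ultimately show "(z \<otimes> x) \<otimes> ((d b \<ominus> d y) \<otimes> word_prod A (B @ C)) \<in> I"
      using b x assms(2) Cons.prems(1) by (simp add: m_assoc del: set_append)
  qed (use Cons.prems x in auto)
  have "z \<otimes> (d (word_prod A (x # xs)) \<ominus> d y \<otimes> word_boundary A (x # xs))
     = z \<otimes> ((d x \<ominus> d y) \<otimes> word_prod A xs)
       \<ominus> (z \<otimes> x) \<otimes> (d (word_prod A xs) \<ominus> d y \<otimes> word_boundary A xs)"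
    using x assms(2) Cons.prems(1) comm
    by (simp add: leibniz word_boundary_Cons a_minus_def l_distr r_distr l_minus r_minus
                  minus_add m_assoc a_ac)
  then show ?case using I.a_closed[OF hd I.a_inv_closed[OF tl]] by (simp add: a_minus_def)
qed

text \<open>The recursion for the boundary gives \<open>d (\<partial> (x w)) = (d w - (d x) (\<partial> w)) + x d (\<partial> w)\<close>. The
bracket is the defect of the previous lemma and covers the pairs of letters that include \<open>x\<close>;
the last term covers the other pairs.\<close>

lemma d_boundary_in_subgroup:
  assumes "additive_subgroup I A" "z \<in> carrier A"
    and "set xs \<subseteq> carrier A"
    and "\<And>x. x \<in> set xs \<Longrightarrow> s x = \<ominus> x"
    and "\<And>x a. \<lbrakk>x \<in> set xs; a \<in> carrier A\<rbrakk> \<Longrightarrow> d x \<otimes> a = a \<otimes> d x"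
    and "\<And>B b C c D. xs = B @ b # C @ c # D \<Longrightarrow> z \<otimes> ((d c \<ominus> d b) \<otimes> word_prod A (B @ C @ D)) \<in> I"
  shows "z \<otimes> d (word_boundary A xs) \<in> I"
  using assms(2-)
proof (induction xs arbitrary: z)
  case Nil
  then show ?case
    using assms(1) by (simp add: additive_subgroup.zero_closed)
next
  case (Cons x xs)
  interpret I: additive_subgroup I A by (rule assms(1))
  have x: "x \<in> carrier A" "set xs \<subseteq> carrier A" "s x = \<ominus> x" using Cons.prems by auto
  have comm: "x \<otimes> (d a \<otimes> u) = d a \<otimes> (x \<otimes> u)"
    if "a \<in> set xs" "u \<in> carrier A" for a u
  proof -
    have "a \<in> carrier A" using that(1) x by auto
    moreover have "d a \<otimes> x = x \<otimes> d a" using that(1) x by (intro Cons.prems(4)) auto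
    ultimately show ?thesis using that(2) x by (simp add: m_assoc[symmetric])
  qed
  have hd: "z \<otimes> (d (word_prod A xs) \<ominus> d x \<otimes> word_boundary A xs) \<in> I"
    using Cons.prems Cons.prems(5)[of "[]" x]
    by (intro boundary_defect_in_subgroup[OF assms(1)]) auto
  have tl: "(z \<otimes> x) \<otimes> d (word_boundary A xs) \<in> I"
  proof (rule Cons.IH)
    fix B b C c D assume eq: "xs = B @ b # C @ c # D"
    then have b: "b \<in> carrier A" "b \<in> set xs" "c \<in> carrier A" "c \<in> set xs"
      "set (B @ C @ D) \<subseteq> carrier A" using x by auto
    have "z \<otimes> ((d c \<ominus> d b) \<otimes> word_prod A ((x # B) @ C @ D)) \<in> I"
      using eq by (intro Cons.prems(5)) simp
    moreover have "x \<otimes> ((d c \<ominus> d b) \<otimes> word_prod A (B @ C @ D))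
        = (d c \<ominus> d b) \<otimes> (x \<otimes> word_prod A (B @ C @ D))"
      using b x comm
      by (simp add: a_minus_def l_distr r_distr l_minus r_minus del: set_append)
    ultimately show "(z \<otimes> x) \<otimes> ((d c \<ominus> d b) \<otimes> word_prod A (B @ C @ D)) \<in> I"
      using b x Cons.prems(1) by (simp add: m_assoc del: set_append)
  qed (use Cons.prems x in auto)
  have "z \<otimes> d (word_boundary A (x # xs))
     = z \<otimes> (d (word_prod A xs) \<ominus> d x \<otimes> word_boundary A xs) \<oplus> (z \<otimes> x) \<otimes> d (word_boundary A xs)"
    using x Cons.prems(1)
    by (simp add: leibniz word_boundary_Cons a_minus_def d_add d_neg l_distr r_distr l_minus r_minus
                  minus_add m_assoc a_ac)
  then show ?case using I.a_closed[OF hd tl] by simp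
qed

end

section \<open>Polynomials and the truncated ring\<close>

lemma poly_ring_simps [simp]:
  "x \<otimes>\<^bsub>poly_ring V\<^esub> y = x * y" "x \<oplus>\<^bsub>poly_ring V\<^esub> y = x + y"
  "\<one>\<^bsub>poly_ring V\<^esub> = 1" "\<zero>\<^bsub>poly_ring V\<^esub> = 0"
  by (simp_all add: poly_ring_def)

lemma poly_ring_carrier:
  "p \<in> carrier (poly_ring V) \<longleftrightarrow> (\<forall>m\<in>Poly_Mapping.keys p. Poly_Mapping.keys m \<subseteq> V)"
  by (simp add: poly_ring_def)

lemma poly_ring_closed [simp]:
  "0 \<in> carrier (poly_ring V)" "1 \<in> carrier (poly_ring V)" "poly_const c \<in> carrier (poly_ring V)"
  "v \<in> V \<Longrightarrow> hvar v \<in> carrier (poly_ring V)"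
  by (auto simp: poly_ring_carrier poly_const_def hvar_def)

lemma poly_ring_add [simp]:
  "\<lbrakk>p \<in> carrier (poly_ring V); q \<in> carrier (poly_ring V)\<rbrakk> \<Longrightarrow> p + q \<in> carrier (poly_ring V)"
  using Poly_Mapping.keys_add[of p q] by (auto simp: poly_ring_carrier)

lemma poly_ring_uminus [simp]: "p \<in> carrier (poly_ring V) \<Longrightarrow> - p \<in> carrier (poly_ring V)"
  by (auto simp: poly_ring_carrier in_keys_iff)

lemma poly_ring_minus [simp]:
  "\<lbrakk>p \<in> carrier (poly_ring V); q \<in> carrier (poly_ring V)\<rbrakk> \<Longrightarrow> p - q \<in> carrier (poly_ring V)"
  using poly_ring_add[of p V "- q"] by simp

lemma poly_ring_mult [simp]:
  assumes "p \<in> carrier (poly_ring V)" "q \<in> carrier (poly_ring V)"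
  shows "p * q \<in> carrier (poly_ring V)"
proof -
  have "Poly_Mapping.keys m \<subseteq> V" if m: "m \<in> Poly_Mapping.keys (p * q)" for m
  proof -
    obtain a b where "m = a + b" "a \<in> Poly_Mapping.keys p" "b \<in> Poly_Mapping.keys q"
      using m Poly_Mapping.keys_mult[of p q] by blast
    then show ?thesis using assms Poly_Mapping.keys_add[of a b] by (fastforce simp: poly_ring_carrier)
  qed
  then show ?thesis by (simp add: poly_ring_carrier)
qed

lemma poly_ring_power [simp]: "p \<in> carrier (poly_ring V) \<Longrightarrow> p ^ k \<in> carrier (poly_ring V)"
  by (induction k) auto

lemma poly_ring_sum: "(\<And>i. i \<in> I \<Longrightarrow> f i \<in> carrier (poly_ring V)) \<Longrightarrow> sum f I \<in> carrier (poly_ring V)"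
  by (induction I rule: infinite_finite_induct) auto

lemma poly_cring: "cring (poly_ring V)"
proof (rule cringI)
  show "abelian_group (poly_ring V)"
    by (rule abelian_groupI) (auto intro!: bexI[of _ "- x" for x])
  show "comm_monoid (poly_ring V)"
    by (rule comm_monoidI) auto
qed (auto simp: algebra_simps)

lemma poly_ring_a_inv:
  assumes "p \<in> carrier (poly_ring V)"
  shows "\<ominus>\<^bsub>poly_ring V\<^esub> p = - p"
proof -
  interpret cring "poly_ring V" by (rule poly_cring)
  show ?thesis using assms by (intro minus_equality) auto
qed

lemma Delta_closed [simp]: "\<lbrakk>u \<in> V; v \<in> V\<rbrakk> \<Longrightarrow> Delta n u v \<in> carrier (poly_ring V)"
  unfolding Delta_def by (intro poly_ring_sum) auto

lemma Delta_commute: "Delta n u v = Delta n v u"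
  unfolding Delta_def
  by (rule sum.reindex_bij_witness[of _ "\<lambda>k. n - 1 - k" "\<lambda>k. n - 1 - k"]) (auto simp: mult.commute)

lemma edge_Delta_eq: "edge_Delta n {u, v} = Delta n u v"
  unfolding edge_Delta_def
  by (rule the_equality) (auto simp: doubleton_eq_iff Delta_commute)

lemma hvar_diff_mult_Delta: "(hvar u - hvar v) * Delta n u v = hvar u ^ n - hvar v ^ n"
  using power_diff_sumr2[of "hvar u" n "hvar v"] by (subst Delta_commute) (simp add: Delta_def)

section \<open>The relations generate a differential ideal\<close>

lemma finite_edges: "simple_graph V E \<Longrightarrow> finite E"
  unfolding simple_graph_def by (meson PowI finite_Pow_iff finite_subset subsetI)

lemma edge_order_linear: "linear_order_on E (edge_order E)"
  unfolding edge_order_def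
  by (rule someI_ex) (use well_order_on[of E] in \<open>auto simp: well_order_on_def\<close>)

lemma trunc_ideal_ideal: "ideal (trunc_ideal V n) (poly_ring V)"
proof -
  interpret cring "poly_ring V" by (rule poly_cring)
  show ?thesis unfolding trunc_ideal_def by (rule genideal_ideal) auto
qed

lemma trunc_cring: "cring (trunc_ring V n)"
  unfolding trunc_ring_def using trunc_ideal_ideal poly_cring by (rule ideal.quotient_is_cring)

lemma trunc_class_hom: "trunc_class V n \<in> ring_hom (poly_ring V) (trunc_ring V n)"
  using ideal.rcos_ring_hom[OF trunc_ideal_ideal[of V n]]
  by (simp add: trunc_ring_def trunc_class_def[abs_def])

lemma trunc_carrierE:
  assumes "t \<in> carrier (trunc_ring V n)"
  obtains p where "p \<in> carrier (poly_ring V)" "t = trunc_class V n p"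
  using assms by (auto simp: trunc_ring_def FactRing_def A_RCOSETS_def' trunc_class_def)

locale edge_algebra =
  fixes V :: "'v set" and E :: "'v set set" and n :: nat
  assumes graph: "simple_graph V E"
begin

lemma edgeE:
  assumes "e \<in> E"
  obtains u v where "e = {u, v}" "u \<in> V" "v \<in> V"
  using assms graph unfolding simple_graph_def by (metis card_2_iff insert_subset)

lemma edge_vertices: "{u, v} \<in> E \<Longrightarrow> u \<in> V \<and> v \<in> V"
  using graph unfolding simple_graph_def by blast

lemma edge_Delta_closed: "e \<in> E \<Longrightarrow> edge_Delta n e \<in> carrier (poly_ring V)"
  by (erule edgeE) (simp add: edge_Delta_eq)

end

sublocale edge_algebra \<subseteq> P: cring "poly_ring V" by (rule poly_cring)
sublocale edge_algebra \<subseteq> T: cring "trunc_ring V n" by (rule trunc_cring)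
sublocale edge_algebra \<subseteq> cls: ring_hom_ring "poly_ring V" "trunc_ring V n" "trunc_class V n"
  by (intro ring_hom_ringI2 P.ring_axioms T.ring_axioms trunc_class_hom)

sublocale edge_algebra \<subseteq> K: exterior_derivation "trunc_ring V n" E "edge_order E"
    "\<lambda>e. trunc_class V n (edge_Delta n e)"
  by unfold_locales (auto simp: finite_edges[OF graph] edge_order_linear edge_Delta_closed)

sublocale edge_algebra \<subseteq> D: dg_ring "ext_alg (trunc_ring V n) E (edge_order E)" K.parity K.diff
  by (rule K.dg_ring)

context edge_algebra
begin

abbreviation Kext where "Kext \<equiv> ext_alg (trunc_ring V n) E (edge_order E)"
abbreviation J where "J \<equiv> J_ideal V E n"
abbreviation g where "g \<equiv> K_g V E n"

definition ext_poly :: "'v rpoly \<Rightarrow> 'v kext" where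
  "ext_poly p = ext_incl (trunc_ring V n) E (trunc_class V n p)"

lemma K_ext_eq [simp]: "K_ext V E n = Kext"
  by (simp add: K_ext_def)

lemma ext_poly_hom: "ext_poly \<in> ring_hom (poly_ring V) Kext"
  using ring_hom_trans[OF trunc_class_hom K.ext_incl_hom] by (simp add: ext_poly_def[abs_def] comp_def)

lemma ext_poly_closed [simp]: "p \<in> carrier (poly_ring V) \<Longrightarrow> ext_poly p \<in> carrier Kext"
  using ext_poly_hom by (rule ring_hom_closed)

lemma ext_poly_mult: "\<lbrakk>p \<in> carrier (poly_ring V); q \<in> carrier (poly_ring V)\<rbrakk>
    \<Longrightarrow> ext_poly (p * q) = ext_poly p \<otimes>\<^bsub>Kext\<^esub> ext_poly q"
  using ring_hom_mult[OF ext_poly_hom] by simp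

lemma ext_poly_add: "\<lbrakk>p \<in> carrier (poly_ring V); q \<in> carrier (poly_ring V)\<rbrakk>
    \<Longrightarrow> ext_poly (p + q) = ext_poly p \<oplus>\<^bsub>Kext\<^esub> ext_poly q"
  using ring_hom_add[OF ext_poly_hom] by simp

lemma ext_poly_zero: "ext_poly 0 = \<zero>\<^bsub>Kext\<^esub>"
  using ring_hom_zero[OF ext_poly_hom P.ring_axioms K.X.ring_axioms] by simp

lemma ext_poly_minus: "\<lbrakk>p \<in> carrier (poly_ring V); q \<in> carrier (poly_ring V)\<rbrakk>
    \<Longrightarrow> ext_poly (p - q) = ext_poly p \<ominus>\<^bsub>Kext\<^esub> ext_poly q"
  using ext_poly_add[of "p - q" q] by (simp add: a_minus_def K.X.a_assoc K.X.r_neg)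

lemma ext_poly_central:
  "\<lbrakk>p \<in> carrier (poly_ring V); a \<in> carrier Kext\<rbrakk> \<Longrightarrow> ext_poly p \<otimes>\<^bsub>Kext\<^esub> a = a \<otimes>\<^bsub>Kext\<^esub> ext_poly p"
  unfolding ext_poly_def by (simp add: K.ext_incl_central)

lemma K_h_eq: "K_h V E n v = ext_poly (hvar v)"
  by (simp add: K_h_def ext_poly_def)

lemma g_closed [simp]: "g e \<in> carrier Kext"
  by (simp add: K_g_def)

lemma g_set_closed [simp]: "g ` X \<subseteq> carrier Kext"
  by auto

lemma diff_g: "e \<in> E \<Longrightarrow> K.diff (g e) = ext_poly (edge_Delta n e)"
  by (simp add: K_g_def K.diff_gen ext_poly_def)

lemma parity_g: "e \<in> E \<Longrightarrow> K.parity (g e) = \<ominus>\<^bsub>Kext\<^esub> g e"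
  by (simp add: K_g_def K.parity_gen)

lemma diff_ext_poly: "p \<in> carrier (poly_ring V) \<Longrightarrow> K.diff (ext_poly p) = \<zero>\<^bsub>Kext\<^esub>"
  by (simp add: ext_poly_def K.diff_incl)

lemma parity_ext_poly: "p \<in> carrier (poly_ring V) \<Longrightarrow> K.parity (ext_poly p) = ext_poly p"
  by (simp add: ext_poly_def K.parity_incl)

lemma trunc_class_hvar_power:
  assumes "v \<in> V"
  shows "trunc_class V n (hvar v ^ n) = \<zero>\<^bsub>trunc_ring V n\<^esub>"
proof -
  have "hvar v ^ n \<in> trunc_ideal V n"
  proof -
    have "{hvar v ^ n |v. v \<in> V} \<subseteq> carrier (poly_ring V)" by auto
    from P.genideal_self[OF this] show ?thesis using assms unfolding trunc_ideal_def by blast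
  qed
  then show ?thesis
    using P.a_rcos_zero[OF trunc_ideal_ideal] by (simp add: trunc_class_def trunc_ring_def FactRing_def)
qed

lemma ext_poly_hvar_power: "v \<in> V \<Longrightarrow> ext_poly (hvar v ^ n) = \<zero>\<^bsub>Kext\<^esub>"
  using ext_poly_zero trunc_class_hvar_power cls.hom_zero by (simp add: ext_poly_def)

definition J_gens :: "'v kext set" where
  "J_gens = {ext_poly (hvar u - hvar v) \<otimes>\<^bsub>Kext\<^esub> g {u, v} | u v. {u, v} \<in> E}
        \<union> {word_boundary Kext (map g es) | es. simple_cycle E es}"

lemma J_eq: "J = Idl\<^bsub>Kext\<^esub> J_gens"
proof -
  have "{(K_h V E n u \<ominus>\<^bsub>K_ext V E n\<^esub> K_h V E n v) \<otimes>\<^bsub>K_ext V E n\<^esub> K_g V E n {u, v} | u v. {u, v} \<in> E}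
     = {ext_poly (hvar u - hvar v) \<otimes>\<^bsub>Kext\<^esub> g {u, v} | u v. {u, v} \<in> E}"
  proof -
    have "(K_h V E n u \<ominus>\<^bsub>K_ext V E n\<^esub> K_h V E n v) \<otimes>\<^bsub>K_ext V E n\<^esub> g {u, v}
        = ext_poly (hvar u - hvar v) \<otimes>\<^bsub>Kext\<^esub> g {u, v}" if "{u, v} \<in> E" for u v
      using edge_vertices[OF that] by (simp add: K_h_eq ext_poly_minus)
    then show ?thesis by (intro Collect_cong) metis
  qed
  then show ?thesis by (simp add: J_ideal_def J_gens_def)
qed

lemma J_gens_carrier: "J_gens \<subseteq> carrier Kext"
  by (auto simp: J_gens_def intro!: K.X.m_closed K.X.word_boundary_closed dest: edge_vertices)

lemma J_ideal: "ideal J Kext"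
  unfolding J_eq using J_gens_carrier by (rule K.X.genideal_ideal)

lemma J_gens_J: "x \<in> J_gens \<Longrightarrow> x \<in> J"
  unfolding J_eq using K.X.genideal_self[OF J_gens_carrier] by blast

end

sublocale edge_algebra \<subseteq> JI: ideal "J_ideal V E n" "ext_alg (trunc_ring V n) E (edge_order E)"
  by (rule J_ideal)

context edge_algebra
begin

text \<open>Congruence of polynomials after multiplication by \<open>w\<close>, modulo \<open>J\<close>. For fixed \<open>w\<close> it is a
congruence of the polynomial ring.\<close>

definition congr_on :: "'v kext \<Rightarrow> 'v rpoly \<Rightarrow> 'v rpoly \<Rightarrow> bool" where
  "congr_on w p q \<longleftrightarrow> p \<in> carrier (poly_ring V) \<and> q \<in> carrier (poly_ring V) \<and>
     ext_poly (p - q) \<otimes>\<^bsub>Kext\<^esub> w \<in> J"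

lemma congr_on_refl: "\<lbrakk>w \<in> carrier Kext; p \<in> carrier (poly_ring V)\<rbrakk> \<Longrightarrow> congr_on w p p"
  by (simp add: congr_on_def ext_poly_zero JI.additive_subgroup_axioms additive_subgroup.zero_closed)

lemma congr_on_add:
  assumes "w \<in> carrier Kext" "congr_on w p q" "congr_on w p' q'"
  shows "congr_on w (p + p') (q + q')"
proof -
  have "p + p' - (q + q') = (p - q) + (p' - q')" by simp
  then have "ext_poly (p + p' - (q + q')) \<otimes>\<^bsub>Kext\<^esub> w
      = ext_poly (p - q) \<otimes>\<^bsub>Kext\<^esub> w \<oplus>\<^bsub>Kext\<^esub> ext_poly (p' - q') \<otimes>\<^bsub>Kext\<^esub> w"
    using assms by (simp only: congr_on_def ext_poly_add poly_ring_minus K.X.l_distr ext_poly_closed)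
  then show ?thesis using assms by (simp add: congr_on_def JI.a_closed)
qed

lemma congr_on_mult:
  assumes "w \<in> carrier Kext" "congr_on w p q" "congr_on w p' q'"
  shows "congr_on w (p * p') (q * q')"
proof -
  have "p * p' - q * q' = p * (p' - q') + q' * (p - q)" by (simp add: algebra_simps)
  then have "ext_poly (p * p' - q * q') \<otimes>\<^bsub>Kext\<^esub> w
      = ext_poly p \<otimes>\<^bsub>Kext\<^esub> (ext_poly (p' - q') \<otimes>\<^bsub>Kext\<^esub> w) \<oplus>\<^bsub>Kext\<^esub> ext_poly q' \<otimes>\<^bsub>Kext\<^esub> (ext_poly (p - q) \<otimes>\<^bsub>Kext\<^esub> w)"
    using assms
    by (simp only: congr_on_def ext_poly_add ext_poly_mult poly_ring_minus poly_ring_mult K.X.l_distr K.X.m_assoc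
          ext_poly_closed K.X.m_closed)
  then show ?thesis using assms by (simp add: congr_on_def JI.a_closed JI.I_l_closed)
qed

lemma congr_on_sym: 
  assumes "w \<in> carrier Kext" "congr_on w p q"
  shows "congr_on w q p"
proof -
  have "ext_poly (q - p) \<otimes>\<^bsub>Kext\<^esub> w = \<ominus>\<^bsub>Kext\<^esub> (ext_poly (p - q) \<otimes>\<^bsub>Kext\<^esub> w)"
    using assms by (simp add: congr_on_def ext_poly_minus a_minus_def K.X.l_distr K.X.l_minus K.X.minus_add K.X.a_comm)
  then show ?thesis using assms by (simp add: congr_on_def JI.a_inv_closed)
qed

lemma congr_on_trans:
  assumes "w \<in> carrier Kext" "congr_on w p q" "congr_on w q s"
  shows "congr_on w p s"
proof -
  have "p - s = (p - q) + (q - s)" by simp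
  then have "ext_poly (p - s) \<otimes>\<^bsub>Kext\<^esub> w
      = ext_poly (p - q) \<otimes>\<^bsub>Kext\<^esub> w \<oplus>\<^bsub>Kext\<^esub> ext_poly (q - s) \<otimes>\<^bsub>Kext\<^esub> w"
    using assms by (simp only: congr_on_def ext_poly_add poly_ring_minus K.X.l_distr ext_poly_closed)
  then show ?thesis using assms by (simp add: congr_on_def JI.a_closed)
qed

lemma congr_on_power: "\<lbrakk>w \<in> carrier Kext; congr_on w p q\<rbrakk> \<Longrightarrow> congr_on w (p ^ k) (q ^ k)"
  by (induction k) (auto intro: congr_on_refl congr_on_mult)

lemma congr_on_Delta:
  assumes w: "w \<in> carrier Kext" and "congr_on w (hvar u) (hvar u')" "congr_on w (hvar v) (hvar v')"
  shows "congr_on w (Delta n u v) (Delta n u' v')"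
proof -
  have "congr_on w (\<Sum>k<m. hvar u ^ (n - 1 - k) * hvar v ^ k) (\<Sum>k<m. hvar u' ^ (n - 1 - k) * hvar v' ^ k)" for m
    using assms by (induction m) (auto intro!: congr_on_refl congr_on_add congr_on_mult congr_on_power)
  then show ?thesis unfolding Delta_def .
qed

text \<open>The product contains the factor \<open>g\<^bsub>uv\<^esub>\<close>, and polynomials are central, so the relation
\<open>(h\<^sub>u - h\<^sub>v) g\<^bsub>uv\<^esub>\<close> can be split off.\<close>

lemma congr_on_edge:
  assumes "set es \<subseteq> E" "{u, v} \<in> set es"
  shows "congr_on (word_prod Kext (map g es)) (hvar u) (hvar v)"
proof -
  obtain xs ys where es: "es = xs @ {u, v} # ys" using assms(2) by (meson split_list)
  have uv: "u \<in> V" "v \<in> V" "{u, v} \<in> E" using assms edge_vertices by auto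
  define p q where "p = word_prod Kext (map g xs)" and "q = word_prod Kext (map g ys)"
  have pq: "p \<in> carrier Kext" "q \<in> carrier Kext" by (simp_all add: p_def q_def)
  have h: "hvar u - hvar v \<in> carrier (poly_ring V)" using uv by simp
  have "ext_poly (hvar u - hvar v) \<otimes>\<^bsub>Kext\<^esub> word_prod Kext (map g es)
      = ext_poly (hvar u - hvar v) \<otimes>\<^bsub>Kext\<^esub> (p \<otimes>\<^bsub>Kext\<^esub> (g {u, v} \<otimes>\<^bsub>Kext\<^esub> q))"
    by (simp add: es K.X.word_prod_append p_def q_def)
  also have "\<dots> = p \<otimes>\<^bsub>Kext\<^esub> ((ext_poly (hvar u - hvar v) \<otimes>\<^bsub>Kext\<^esub> g {u, v}) \<otimes>\<^bsub>Kext\<^esub> q)"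
    using pq ext_poly_closed[OF h] ext_poly_central[OF h pq(1)] by (simp add: K.X.m_assoc[symmetric])
  also have "\<dots> \<in> J"
  proof -
    have "ext_poly (hvar u - hvar v) \<otimes>\<^bsub>Kext\<^esub> g {u, v} \<in> J"
      using uv by (intro J_gens_J) (auto simp: J_gens_def)
    then show ?thesis using pq by (blast intro: JI.I_l_closed JI.I_r_closed)
  qed
  finally show ?thesis using uv by (simp add: congr_on_def)
qed

text \<open>Deleting \<open>a\<close> and \<open>b\<close> cuts the cycle into two arcs, possibly consisting of a single vertex.
Walking along them identifies the end of \<open>a\<close> with the start of \<open>b\<close>, and the end of \<open>b\<close> with the
start of \<open>a\<close>. So \<open>a\<close> and \<open>b\<close> become the same pair of variables in opposite order, and \<open>\<Delta>\<close> is
symmetric.\<close>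

lemma cycle_two_edges:
  assumes vs: "distinct vs" "3 \<le> length vs" "set (cycle_edges vs) \<subseteq> E"
    and es: "cycle_edges vs = A @ a # B @ b # C"
  shows "ext_poly (edge_Delta n b - edge_Delta n a) \<otimes>\<^bsub>Kext\<^esub> word_prod Kext (map g (A @ B @ C)) \<in> J"
proof -
  define k where "k = length vs"
  define i j where "i = length A" and "j = Suc (length A + length B)"
  define w where "w = word_prod Kext (map g (A @ B @ C))"
  \<comment> \<open>Vertices are read cyclically, so that the arc from \<open>b\<close> back to \<open>a\<close> is walked by increasing indices up to \<open>i + k\<close>.\<close>
  define x where "x l = vs ! (l mod k)" for l
  have len: "length (cycle_edges vs) = k" by (simp add: cycle_edges_def k_def)
  have k: "3 \<le> k" "i < j" "j < k" using vs len by (auto simp: k_def i_def j_def es)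
  have w: "w \<in> carrier Kext" by (simp add: w_def)
  have nth: "cycle_edges vs ! l = {x l, x (Suc l)}" if "l < k" for l
    using that by (simp add: cycle_edges_def k_def x_def)
  have ab: "a = {x i, x (Suc i)}" "b = {x j, x (Suc j)}"
    using nth[of i] nth[of j] k by (simp_all add: es i_def j_def nth_append)
  have step: "congr_on w (hvar (x l)) (hvar (x (Suc l)))" if l: "l mod k \<noteq> i" "l mod k \<noteq> j" for l
  proof -
    define m where "m = l mod k"
    have m: "m < k" "m \<noteq> i" "m \<noteq> j" using k l by (auto simp: m_def)
    have eq: "{x l, x (Suc l)} = cycle_edges vs ! m"
      using nth[OF m(1)] by (simp add: x_def m_def mod_Suc_eq)
    have "cycle_edges vs ! m \<in> set (A @ B @ C)"
    proof -
      consider "m < i" | "i < m" "m < j" | "j < m" using m by linarith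
      then show ?thesis
      proof cases
        case 1
        then show ?thesis by (simp add: es nth_append i_def)
      next
        case 2
        then have "cycle_edges vs ! m = B ! (m - Suc i)" "m - Suc i < length B"
          by (auto simp: es nth_append i_def j_def nth_Cons')
        then show ?thesis by simp
      next
        case 3
        then have "cycle_edges vs ! m = C ! (m - Suc j)" "m - Suc j < length C"
          using m(1) len by (auto simp: es nth_append i_def j_def nth_Cons' Suc_diff_Suc)
        then show ?thesis by simp
      qed
    qed
    then show ?thesis
      unfolding w_def using vs(3) es eq by (intro congr_on_edge) auto
  qed
  have x_V: "x l \<in> V" for l
    using nth[of "l mod k"] k vs(3) len edge_vertices[of "x l" "x (Suc (l mod k))"]
      nth_mem[of "l mod k" "cycle_edges vs"] by (auto simp: x_def)
  have walk: "congr_on w (hvar (x l)) (hvar (x (l + m)))"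
    if "\<And>l'. \<lbrakk>l \<le> l'; l' < l + m\<rbrakk> \<Longrightarrow> l' mod k \<noteq> i \<and> l' mod k \<noteq> j" for l m
    using that
  proof (induction m)
    case 0
    then show ?case using w x_V by (simp add: congr_on_refl)
  next
    case (Suc m)
    then show ?case using step[of "l + m"] congr_on_trans[OF w, of "hvar (x l)" "hvar (x (l + m))"] by simp
  qed
  have "congr_on w (hvar (x (Suc i))) (hvar (x (Suc i + (j - Suc i))))"
    using k by (intro walk) auto
  then have 1: "congr_on w (hvar (x (Suc i))) (hvar (x j))" using k by simp
  have "congr_on w (hvar (x (Suc j))) (hvar (x (Suc j + (i + k - Suc j))))"
  proof (rule walk)
    fix l assume "Suc j \<le> l" "l < Suc j + (i + k - Suc j)"
    then show "l mod k \<noteq> i \<and> l mod k \<noteq> j"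
      using k by (cases "l < k") (auto simp: le_mod_geq mod_if)
  qed
  moreover have "x (Suc j + (i + k - Suc j)) = x i" using k by (simp add: x_def)
  ultimately have 2: "congr_on w (hvar (x (Suc j))) (hvar (x i))" by simp
  have "congr_on w (Delta n (x (Suc j)) (x j)) (Delta n (x i) (x (Suc i)))"
    using w 1 2 congr_on_sym by (intro congr_on_Delta) auto
  then show ?thesis
    unfolding ab edge_Delta_eq w_def[symmetric] by (simp add: congr_on_def Delta_commute[of n "x j"])
qed

lemma J_gens_stable:
  assumes "x \<in> J_gens"
  shows "K.diff x \<in> J" and "K.parity x \<in> J"
proof -
  consider (edge) u v where "{u, v} \<in> E" "x = ext_poly (hvar u - hvar v) \<otimes>\<^bsub>Kext\<^esub> g {u, v}"
    | (cycle) es where "simple_cycle E es" "x = word_boundary Kext (map g es)"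
    using assms by (auto simp: J_gens_def)
  then have "K.diff x \<in> J \<and> K.parity x \<in> J"
  proof cases
    case edge
    have uv: "u \<in> V" "v \<in> V" using edge_vertices[OF edge(1)] by auto
    then have h: "hvar u - hvar v \<in> carrier (poly_ring V)" by simp
    have "K.diff x = ext_poly ((hvar u - hvar v) * Delta n u v)"
      using edge uv h by (simp add: D.leibniz diff_ext_poly parity_ext_poly diff_g edge_Delta_eq ext_poly_mult)
    also have "\<dots> = \<zero>\<^bsub>Kext\<^esub>"
      using uv by (simp add: hvar_diff_mult_Delta ext_poly_minus ext_poly_hvar_power a_minus_def)
    finally have "K.diff x \<in> J" by simp
    moreover have "K.parity x = \<ominus>\<^bsub>Kext\<^esub> x"
      using edge h by (simp add: D.s_mult parity_ext_poly parity_g K.X.r_minus)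
    ultimately show ?thesis using J_gens_J[OF assms] by (simp add: JI.a_inv_closed)
  next
    case cycle
    obtain vs where vs: "distinct vs" "3 \<le> length vs" "es = cycle_edges vs" "set es \<subseteq> E"
      using cycle(1) by (auto simp: simple_cycle_def)
    have odd: "K.parity y = \<ominus>\<^bsub>Kext\<^esub> y" if "y \<in> set (map g es)" for y
      using that vs(4) by (auto simp: parity_g)
    have "\<one>\<^bsub>Kext\<^esub> \<otimes>\<^bsub>Kext\<^esub> K.diff x \<in> J"
      unfolding cycle(2)
    proof (rule D.d_boundary_in_subgroup[OF JI.additive_subgroup_axioms])
      show "K.diff y \<otimes>\<^bsub>Kext\<^esub> z = z \<otimes>\<^bsub>Kext\<^esub> K.diff y"
        if "y \<in> set (map g es)" "z \<in> carrier Kext" for y z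
        using that vs(4) by (auto simp: diff_g intro!: ext_poly_central edge_Delta_closed)
      fix B b C c D' assume "map g es = B @ b # C @ c # D'"
      then obtain B' b' C' c' D'' where es: "es = B' @ b' # C' @ c' # D''"
        and eq: "B = map g B'" "b = g b'" "C = map g C'" "c = g c'" "D' = map g D''"
        by (auto simp: map_eq_append_conv map_eq_Cons_conv append_eq_map_conv Cons_eq_map_conv)
      have bc: "b' \<in> E" "c' \<in> E" using vs(4) es by auto
      have "ext_poly (edge_Delta n c' - edge_Delta n b') \<otimes>\<^bsub>Kext\<^esub> word_prod Kext (map g (B' @ C' @ D'')) \<in> J"
        using vs es by (intro cycle_two_edges[of vs]) auto
      then show "\<one>\<^bsub>Kext\<^esub> \<otimes>\<^bsub>Kext\<^esub> ((K.diff c \<ominus>\<^bsub>Kext\<^esub> K.diff b) \<otimes>\<^bsub>Kext\<^esub> word_prod Kext (B @ C @ D')) \<in> J"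
        using bc by (simp add: eq diff_g ext_poly_minus edge_Delta_closed flip: map_append)
    qed (use odd in auto)
    moreover have "x \<in> carrier Kext" using assms J_gens_carrier by blast
    ultimately have "K.diff x \<in> J" by simp
    moreover have "K.parity x \<in> {x, \<ominus>\<^bsub>Kext\<^esub> x}"
      unfolding cycle(2) using D.s_word[of "map g es"] odd by auto
    ultimately show ?thesis using J_gens_J[OF assms] by (auto simp: JI.a_inv_closed)
  qed
  then show "K.diff x \<in> J" and "K.parity x \<in> J" by auto
qed

lemma diff_J: "x \<in> J \<Longrightarrow> K.diff x \<in> J"
  and parity_J: "x \<in> J \<Longrightarrow> K.parity x \<in> J"
  using D.genideal_stable[OF J_gens_carrier] J_gens_stable unfolding J_eq by blast+

text \<open>The coefficient at the empty set is the component of \<open>g\<close>-degree zero. It is multiplicative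
because the empty set is the union of two disjoint sets only trivially.\<close>

lemma coeff_empty_hom: "(\<lambda>a. a {}) \<in> ring_hom Kext (trunc_ring V n)"
  by (rule ring_hom_memI) (auto simp: K.ext_add K.ext_mult K.ext_one K.ext_incl_coeff)

text \<open>The kernel of \<open>coeff_empty_hom\<close> is an ideal that contains every \<open>g\<^sub>e\<close>, hence the edge relations;
it contains the boundary of a word of at least two letters, because each term of such a boundary
still has a letter.\<close>

lemma J_coeff_empty:
  assumes "x \<in> J"
  shows "x {} = \<zero>\<^bsub>trunc_ring V n\<^esub>"
proof -
  interpret c: ring_hom_ring Kext "trunc_ring V n" "\<lambda>a. a {}"
    by (intro ring_hom_ringI2 K.X.ring_axioms T.ring_axioms coeff_empty_hom)
  have g0: "g e {} = \<zero>\<^bsub>trunc_ring V n\<^esub>" for e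
    by (simp add: K_g_def K.ext_gen_coeff)
  let ?I = "{a \<in> carrier Kext. a {} \<in> {\<zero>\<^bsub>trunc_ring V n\<^esub>}}"
  have "J_gens \<subseteq> ?I"
  proof
    fix y assume y: "y \<in> J_gens"
    then consider (edge) u v where "{u, v} \<in> E" "y = ext_poly (hvar u - hvar v) \<otimes>\<^bsub>Kext\<^esub> g {u, v}"
      | (cycle) es where "simple_cycle E es" "y = word_boundary Kext (map g es)"
      by (auto simp: J_gens_def)
    then have "y {} = \<zero>\<^bsub>trunc_ring V n\<^esub>"
    proof cases
      case edge
      then show ?thesis using edge_vertices[OF edge(1)] by (simp add: c.hom_mult g0)
    next
      case cycle
      then obtain vs where "3 \<le> length vs" "es = cycle_edges vs"
        by (auto simp: simple_cycle_def)
      then have "2 \<le> length es" by (simp add: cycle_edges_def)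
      then obtain e f fs where "es = e # f # fs"
        by (metis Suc_le_length_iff numeral_2_eq_2)
      then show ?thesis
        using cycle(2)
        by (simp add: K.X.word_boundary_Cons[of _ "g f # map g fs"] a_minus_def g0)
    qed
    then show "y \<in> ?I" using y J_gens_carrier by auto
  qed
  then have "J \<subseteq> ?I"
    unfolding J_eq by (intro K.X.genideal_minimal c.ideal_vimage T.zeroideal)
  then show ?thesis using assms by auto
qed

section \<open>Cohomology and the map from polynomials\<close>

definition K_poly :: "'v rpoly \<Rightarrow> 'v kext set" where
  "K_poly p = J +>\<^bsub>Kext\<^esub> ext_poly p"

lemma K_class_eq: "K_class V E n a = J +>\<^bsub>Kext\<^esub> a"
  by (simp add: K_class_def)

lemma K_incl_eq: "K_incl V E n (trunc_class V n p) = K_poly p"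
  by (simp add: K_incl_def K_class_eq K_poly_def ext_poly_def)

lemma K_alg_eq: "K_alg V E n = Kext Quot J"
  by (simp add: K_alg_def)

lemma K_diff_eq: "K_diff V E n = coset_map Kext J K.diff"
  by (simp add: fun_eq_iff K_diff_def coset_map_def K_class_eq K_ext_diff_def)

end

sublocale edge_algebra \<subseteq> Q: dg_ring "K_alg V E n" "coset_map Kext J K.parity" "K_diff V E n"
  unfolding K_alg_eq K_diff_eq by (rule D.quotient_dg_ring[OF J_ideal diff_J parity_J])

context edge_algebra
begin

lemma class_hom: "(+>\<^bsub>Kext\<^esub>) J \<in> ring_hom Kext (K_alg V E n)"
  unfolding K_alg_eq by (rule JI.rcos_ring_hom)

lemma K_diff_class: "a \<in> carrier Kext \<Longrightarrow> K_diff V E n (J +>\<^bsub>Kext\<^esub> a) = J +>\<^bsub>Kext\<^esub> K.diff a"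
  unfolding K_diff_eq
  by (rule JI.coset_map_coset) (auto simp: D.d_add diff_J)

lemma K_alg_carrierE:
  assumes "X \<in> carrier (K_alg V E n)"
  obtains a where "a \<in> carrier Kext" "X = J +>\<^bsub>Kext\<^esub> a"
  using assms by (auto simp: K_alg_eq FactRing_def A_RCOSETS_def')

lemma K_cocycles_eq: "K_cocycles V E n = Q.cocycles"
  by (simp add: K_cocycles_def Q.cocycles_def)

lemma K_coboundaries_eq: "K_coboundaries V E n = Q.coboundaries"
  by (simp add: K_coboundaries_def Q.coboundaries_def)

lemma K_cocycle_ring: "ring (K_cocycle_ring V E n)"
  unfolding K_cocycle_ring_def K_cocycles_eq by (rule Q.cocycle_ring)

lemma K_coboundaries_ideal: "ideal (K_coboundaries V E n) (K_cocycle_ring V E n)"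
  unfolding K_cocycle_ring_def K_cocycles_eq K_coboundaries_eq by (rule Q.coboundaries_ideal)

lemma K_poly_cocycle: "p \<in> carrier (poly_ring V) \<Longrightarrow> K_poly p \<in> K_cocycles V E n"
  using ring_hom_closed[OF class_hom] ring_hom_zero[OF class_hom K.X.ring_axioms Q.ring_axioms]
  by (simp add: K_cocycles_def K_poly_def K_diff_class diff_ext_poly)

lemma K_poly_hom: "K_poly \<in> ring_hom (poly_ring V) (K_cocycle_ring V E n)"
proof -
  have hom: "K_poly \<in> ring_hom (poly_ring V) (K_alg V E n)"
    using ring_hom_trans[OF ext_poly_hom class_hom] by (simp add: K_poly_def[abs_def] comp_def)
  show ?thesis
    by (rule ring_hom_memI)
       (use ring_hom_mult[OF hom] ring_hom_add[OF hom] ring_hom_one[OF hom] K_poly_cocycle in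
         \<open>simp_all add: K_cocycle_ring_def\<close>)
qed

definition H_poly :: "'v rpoly \<Rightarrow> 'v kext set set" where
  "H_poly p = H_class V E n (K_poly p)"

lemma H_class_hom: "H_class V E n \<in> ring_hom (K_cocycle_ring V E n) (H_alg V E n)"
  using ideal.rcos_ring_hom[OF K_coboundaries_ideal] by (simp add: H_alg_def H_class_def[abs_def])

lemma H_poly_hom: "ring_hom_ring (poly_ring V) (H_alg V E n) H_poly"
proof (rule ring_hom_ringI2)
  show "ring (H_alg V E n)"
    unfolding H_alg_def using K_coboundaries_ideal by (rule ideal.quotient_is_ring)
  show "H_poly \<in> ring_hom (poly_ring V) (H_alg V E n)"
    using ring_hom_trans[OF K_poly_hom H_class_hom] by (simp add: H_poly_def[abs_def] comp_def)
qed (rule P.ring_axioms)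

lemma H_poly_zero_iff:
  assumes "p \<in> carrier (poly_ring V)"
  shows "H_poly p = \<zero>\<^bsub>H_alg V E n\<^esub> \<longleftrightarrow> K_poly p \<in> K_coboundaries V E n"
proof -
  interpret B: ideal "K_coboundaries V E n" "K_cocycle_ring V E n" by (rule K_coboundaries_ideal)
  have "K_poly p \<in> carrier (K_cocycle_ring V E n)"
    using K_poly_cocycle[OF assms] by (simp add: K_cocycle_ring_def)
  then show ?thesis
    using B.a_rcos_zero[OF K_coboundaries_ideal] B.rcos_const_imp_mem
    by (auto simp: H_poly_def H_class_def H_alg_def FactRing_def)
qed

lemma R_gens_carrier:
  "{hvar v ^ n | v. v \<in> V} \<union> {Delta n u v | u v. {u, v} \<in> E} \<subseteq> carrier (poly_ring V)"
  using edge_vertices by auto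

lemma R_ideal: "ideal (R_ideal V E n) (poly_ring V)"
  unfolding R_ideal_def using R_gens_carrier by (rule P.genideal_ideal)

lemma trunc_ideal_subset: "trunc_ideal V n \<subseteq> R_ideal V E n"
  unfolding trunc_ideal_def R_ideal_def using R_gens_carrier by (intro P.subset_Idl_subset) auto

lemma Delta_R_ideal: "{u, v} \<in> E \<Longrightarrow> Delta n u v \<in> R_ideal V E n"
  unfolding R_ideal_def using P.genideal_self[OF R_gens_carrier] by blast

text \<open>For the inclusion from left to right, a relation \<open>p - d a \<in> J\<close> is evaluated at the empty set,
where \<open>J\<close> vanishes and \<open>d a\<close> is a combination of the \<open>\<Delta>\<^sub>e\<close>. This determines \<open>p\<close> in the truncated
ring, hence up to the powers \<open>h\<^sub>v ^ n\<close>, which also lie in the ideal.\<close>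

lemma kernel_H_poly: "a_kernel (poly_ring V) (H_alg V E n) H_poly = R_ideal V E n"
proof
  interpret H_poly: ring_hom_ring "poly_ring V" "H_alg V E n" H_poly by (rule H_poly_hom)
  have "hvar v ^ n \<in> a_kernel (poly_ring V) (H_alg V E n) H_poly" if "v \<in> V" for v
  proof -
    have "K_poly (hvar v ^ n) = K_poly 0"
      using that by (simp add: K_poly_def ext_poly_hvar_power ext_poly_zero)
    then have "H_poly (hvar v ^ n) = H_poly \<zero>\<^bsub>poly_ring V\<^esub>" by (simp add: H_poly_def)
    also have "\<dots> = \<zero>\<^bsub>H_alg V E n\<^esub>" by (rule H_poly.hom_zero)
    finally show ?thesis using that unfolding a_kernel_def' by simp
  qed
  moreover have "Delta n u v \<in> a_kernel (poly_ring V) (H_alg V E n) H_poly" if "{u, v} \<in> E" for u v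
  proof -
    have "K_poly (Delta n u v) = K_diff V E n (J +>\<^bsub>Kext\<^esub> g {u, v})"
      using that by (simp add: K_diff_class diff_g edge_Delta_eq K_poly_def)
    then have "K_poly (Delta n u v) \<in> K_coboundaries V E n"
      using ring_hom_closed[OF class_hom g_closed] by (simp add: K_coboundaries_def)
    then show ?thesis
      unfolding a_kernel_def' using edge_vertices[OF that] by (simp add: H_poly_zero_iff)
  qed
  ultimately show "R_ideal V E n \<subseteq> a_kernel (poly_ring V) (H_alg V E n) H_poly"
    unfolding R_ideal_def by (intro P.genideal_minimal H_poly.kernel_is_ideal) auto
next
  show "a_kernel (poly_ring V) (H_alg V E n) H_poly \<subseteq> R_ideal V E n"
  proof
    fix p assume "p \<in> a_kernel (poly_ring V) (H_alg V E n) H_poly"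
    then have p: "p \<in> carrier (poly_ring V)" "K_poly p \<in> K_coboundaries V E n"
      unfolding a_kernel_def' by (auto simp: H_poly_zero_iff)
    then obtain a where a: "a \<in> carrier Kext" "K_poly p = J +>\<^bsub>Kext\<^esub> K.diff a"
      by (auto simp: K_coboundaries_def K_diff_class elim!: K_alg_carrierE)
    then have "ext_poly p \<ominus>\<^bsub>Kext\<^esub> K.diff a \<in> J"
      using K.X.quotient_eq_iff_same_a_r_cos[OF J_ideal] p by (simp add: K_poly_def)
    then have "(ext_poly p \<ominus>\<^bsub>Kext\<^esub> K.diff a) {} = \<zero>\<^bsub>trunc_ring V n\<^esub>" by (rule J_coeff_empty)
    then have "ext_poly p {} \<ominus>\<^bsub>trunc_ring V n\<^esub> K.diff a {} = \<zero>\<^bsub>trunc_ring V n\<^esub>"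
      using a p by (simp add: a_minus_def K.ext_add K.ext_neg)
    then have "trunc_class V n p = K.diff a {}"
      using a p by (simp add: T.r_right_minus_eq ext_poly_def K.ext_incl_coeff)
    moreover have "K.diff a {} \<in> trunc_class V n ` R_ideal V E n"
    proof -
      have I: "ideal (trunc_class V n ` R_ideal V E n) (trunc_ring V n)"
        using P.ring_ideal_imp_quot_ideal[OF trunc_ideal_ideal R_ideal]
        by (simp add: trunc_ring_def trunc_class_def[abs_def])
      show ?thesis
        unfolding K.diff_coeff[OF a(1) empty_subsetI]
      proof (rule ideal_finsum[OF I])
        fix e assume e: "e \<in> E"
        then obtain u v where "e = {u, v}" by (rule edgeE)
        then have "trunc_class V n (edge_Delta n e) \<in> trunc_class V n ` R_ideal V E n"
          using e by (simp add: edge_Delta_eq Delta_R_ideal)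
        then show "trunc_class V n (edge_Delta n e) \<otimes>\<^bsub>trunc_ring V n\<^esub> K.contraction e a {}
            \<in> trunc_class V n ` R_ideal V E n"
          using e a by (intro ideal.I_r_closed[OF I]) auto
      qed
    qed
    ultimately obtain q where q: "q \<in> R_ideal V E n" "trunc_class V n p = trunc_class V n q" by auto
    have q': "q \<in> carrier (poly_ring V)" using q(1) ideal.Icarr[OF R_ideal] by blast
    have "p \<ominus>\<^bsub>poly_ring V\<^esub> q \<in> trunc_ideal V n"
      using P.quotient_eq_iff_same_a_r_cos[OF trunc_ideal_ideal p(1) q'] q(2)
      by (simp add: trunc_class_def)
    then have "(p \<ominus>\<^bsub>poly_ring V\<^esub> q) \<oplus>\<^bsub>poly_ring V\<^esub> q \<in> R_ideal V E n"
      using trunc_ideal_subset q(1) additive_subgroup.a_closed[OF ideal.axioms(1)[OF R_ideal]] by blast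
    then show "p \<in> R_ideal V E n"
      using p(1) q' by (simp add: a_minus_def poly_ring_a_inv)
  qed
qed

text \<open>The coefficients at nonempty sets are zero, and zero is homogeneous of every degree.\<close>

lemma K_poly_degree:
  assumes "p \<in> carrier (poly_ring V)" "poly_homogeneous k p"
  shows "K_poly p \<in> K_deg V E n k"
proof -
  have "ext_poly p S \<in> trunc_deg V n (k - (2 * int n - 3) * int (card S))" if "S \<subseteq> E" for S
  proof (cases "S = {}")
    case True
    then show ?thesis using assms by (auto simp: ext_poly_def K.ext_incl_coeff trunc_deg_def)
  next
    case False
    have "poly_homogeneous l 0" for l :: int by (simp add: poly_homogeneous_def)
    then have "trunc_class V n 0 \<in> trunc_deg V n l" for l
      unfolding trunc_deg_def by (intro CollectI exI[of _ 0]) simp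
    then show ?thesis using that False cls.hom_zero by (simp add: ext_poly_def K.ext_incl_coeff)
  qed
  then show ?thesis using assms(1) by (auto simp: K_deg_def K_poly_def K_class_eq)
qed

lemma K_poly_image: "K_poly ` carrier (poly_ring V) = K_gdeg V E n 0"
proof (intro equalityI subsetI)
  fix X assume "X \<in> K_poly ` carrier (poly_ring V)"
  then obtain p where p: "p \<in> carrier (poly_ring V)" "X = K_poly p" by auto
  have "ext_poly p S = \<zero>\<^bsub>trunc_ring V n\<^esub>" if "S \<subseteq> E" "card S \<noteq> 0" for S
    using that by (auto simp: ext_poly_def K.ext_incl_coeff)
  then show "X \<in> K_gdeg V E n 0"
    unfolding K_gdeg_def using p by (intro CollectI exI[of _ "ext_poly p"]) (simp add: K_poly_def K_class_eq)
next
  fix X assume "X \<in> K_gdeg V E n 0"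
  then obtain a where a: "a \<in> carrier Kext" "X = J +>\<^bsub>Kext\<^esub> a"
    "\<And>S. \<lbrakk>S \<subseteq> E; card S \<noteq> 0\<rbrakk> \<Longrightarrow> a S = \<zero>\<^bsub>trunc_ring V n\<^esub>"
    by (auto simp: K_gdeg_def K_class_eq)
  obtain p where p: "p \<in> carrier (poly_ring V)" "a {} = trunc_class V n p"
    using K.ext_coeff[OF a(1), of "{}"] by (auto elim: trunc_carrierE)
  have "a = ext_poly p"
  proof (rule K.ext_eqI)
    fix S assume S: "S \<subseteq> E"
    then show "a S = ext_poly p S"
      using a(3)[OF S] p by (auto simp: ext_poly_def K.ext_incl_coeff)
  qed (use a p in auto)
  then show "X \<in> K_poly ` carrier (poly_ring V)" using a p by (auto simp: K_poly_def)
qed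

end

theorem proposition7p3:
  fixes V :: "'v set" and E :: "'v set set" and n :: nat
  assumes "simple_graph V E" and "2 \<le> n"
  shows "\<exists>\<phi>. (\<forall>p\<in>carrier (poly_ring V).
                \<phi> (R_class V E n p) = H_class V E n (K_incl V E n (trunc_class V n p))) \<and>
             graded_alg_hom (R_alg V E n) (R_unit V E n) (R_deg V E n)
                            (H_alg V E n) (H_unit V E n) (H_deg V E n) \<phi> \<and>
             inj_on \<phi> (carrier (R_alg V E n)) \<and>
             \<phi> ` carrier (R_alg V E n) =
               {H_class V E n X | X. X \<in> K_cocycles V E n \<inter> K_gdeg V E n 0}"
proof -
  interpret edge_algebra V E n by unfold_locales (rule assms(1))
  interpret H_poly: ring_hom_ring "poly_ring V" "H_alg V E n" H_poly by (rule H_poly_hom)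
  define \<phi> where "\<phi> X = the_elem (H_poly ` X)" for X
  have R_alg: "R_alg V E n = poly_ring V Quot a_kernel (poly_ring V) (H_alg V E n) H_poly"
    by (simp add: R_alg_def kernel_H_poly)
  have \<phi>: "\<phi> (R_class V E n p) = H_class V E n (K_incl V E n (trunc_class V n p))"
    if "p \<in> carrier (poly_ring V)" for p
    using H_poly.the_elem_simp[OF that] by (simp add: \<phi>_def R_class_def kernel_H_poly H_poly_def K_incl_eq)
  have "graded_alg_hom (R_alg V E n) (R_unit V E n) (R_deg V E n)
          (H_alg V E n) (H_unit V E n) (H_deg V E n) \<phi>"
    unfolding graded_alg_hom_def
  proof (intro conjI allI)
    have "ring (R_alg V E n)"
      unfolding R_alg_def using R_ideal by (rule ideal.quotient_is_ring)
    moreover have "\<phi> \<in> ring_hom (R_alg V E n) (H_alg V E n)"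
      unfolding R_alg \<phi>_def[abs_def] by (rule H_poly.the_elem_hom)
    ultimately show "ring_hom_ring (R_alg V E n) (H_alg V E n) \<phi>"
      by (intro ring_hom_ringI2 H_poly.S.ring_axioms)
    show "\<phi> (R_unit V E n c) = H_unit V E n c" for c
      by (simp add: R_unit_def H_unit_def \<phi>)
    show "\<phi> ` R_deg V E n k \<subseteq> H_deg V E n k" for k
      using K_poly_degree K_poly_cocycle by (auto simp: R_deg_def H_deg_def \<phi> K_incl_eq)
  qed
  moreover have "inj_on \<phi> (carrier (R_alg V E n))"
    unfolding R_alg \<phi>_def[abs_def] by (intro inj_onI H_poly.the_elem_inj)
  moreover have "\<phi> ` carrier (R_alg V E n) = H_poly ` carrier (poly_ring V)"
    unfolding R_alg \<phi>_def[abs_def] by (rule H_poly.the_elem_surj)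
  moreover have "H_poly ` carrier (poly_ring V)
      = {H_class V E n X | X. X \<in> K_cocycles V E n \<inter> K_gdeg V E n 0}"
    using K_poly_cocycle by (auto simp: H_poly_def simp flip: K_poly_image)
  ultimately show ?thesis using \<phi> by (intro exI[of _ \<phi>]) simp
qed

end
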